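(* Suppose $E:\mathcal{P}_{2,\omega_0}(\mathbb{R}^d)\to\mathbb{R}\cup\{+\infty\}$ is proper, coercive, lower semicontinuous and $\lambda$-convex along generalized geodesics for some $\lambda\in\mathbb{R}$, and let $\mu\in D(|\partial E|)$. For $t>0$ and a partition $0=t_0<t_1<\dots<t_m=t$ with time steps $h_i=t_i-t_{i-1}$ and $|\boldsymbol h|=\max_{1\le i\le m}h_i$, the discrete gradient flow $J_{h_m}\circ\cdots\circ J_{h_1}\mu$ converges in $W_2$ to the gradient flow $S(t)\mu=\lim_{n\to\infty}J^n_{t/n}\mu$ as $|\boldsymbol h|\to0$, uniformly in $t$ on compact subsets of $[0,+\infty)$. Moreover, when $|\boldsymbol h|\le\frac1{2\lambda^-}$, $$W_2\big(S(t)\mu,J_{h_m}\circ\cdots\circ J_{h_1}\mu\big)\le2\big[|\boldsymbol h|^2+3|\boldsymbol h|t\big]^{1/2}e^{4\lambda^-t}|\partial E|(\mu).$$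
   Context: Fix a probability measure $\omega_0$ on $\mathbb{R}^d$. $W_2$ is the quadratic Wasserstein distance, $\Gamma_0$ the optimal couplings; $\mathcal{P}_{2,\omega_0}(\mathbb{R}^d)=\{\mu:W_2(\mu,\omega_0)<\infty\}$. A transport plan from $\mu_0$ to $\mu_1$ with base $\omega$ is $\boldsymbol\omega\in\mathcal{P}((\mathbb{R}^d)^3)$ with $\pi^{1,2}\#\boldsymbol\omega\in\Gamma_0(\omega,\mu_0)$, $\pi^{1,3}\#\boldsymbol\omega\in\Gamma_0(\omega,\mu_1)$; generalized geodesic $\mu_\alpha=((1-\alpha)\pi^2+\alpha\pi^3)\#\boldsymbol\omega$; $W_{2,\boldsymbol\omega}(\mu_0,\mu_1)=(\int|x_2-x_3|^2d\boldsymbol\omega)^{1/2}$. $D(E)=\{E<\infty\}$; proper: $D(E)\ne\emptyset$; coercive: $\exists\tau_0>0,u_0$ with $\inf_v\{\frac1{2\tau_0}W_2^2(u_0,v)+E(v)\}>-\infty$; lower semicontinuous w.r.t. $W_2$; $\lambda$-convex along generalized geodesics: for all $\mu_0,\mu_1,\omega$ there is a generalized geodesic from $\mu_0$ to $\mu_1$ with base $\omega$ (induced by some $\boldsymbol\omega$) with $E(\mu_\alpha)\le(1-\alpha)E(\mu_0)+\alpha E(\mu_1)-\alpha(1-\alpha)\frac\lambda2W^2_{2,\boldsymbol\omega}(\mu_0,\mu_1)$. $\lambda^-=\max\{0,-\lambda\}$, $1/\lambda^-=+\infty$ if $\lambda^-=0$. $J_\tau\mu=\operatorname{argmin}_\nu\{\frac1{2\tau}W_2^2(\mu,\nu)+E(\nu)\}$,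 $J^n_\tau$ its $n$-fold iterate; the limit $S(t)\mu=\lim_{n\to\infty}J^n_{t/n}\mu$ exists and is the Wasserstein gradient flow of $E$ from $\mu$. Metric slope $|\partial E|(\mu)=\limsup_{\nu\to\mu}(E(\mu)-E(\nu))^+/W_2(\mu,\nu)$; $D(|\partial E|)=\{\mu\in D(E):|\partial E|(\mu)<\infty\}$. *)

theory Defs
  imports "HOL-Probability.Probability"
begin

definition Pm :: "'a::euclidean_space measure set" where
  "Pm = {\<mu>. prob_space \<mu> \<and> sets \<mu> = sets borel}"

definition couplings :: "'a::euclidean_space measure \<Rightarrow> 'a measure \<Rightarrow> ('a \<times> 'a) measure set" where
  "couplings \<mu> \<nu> = {\<gamma>. prob_space \<gamma> \<and> sets \<gamma> = sets borel \<and>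
      distr \<gamma> borel fst = \<mu> \<and> distr \<gamma> borel snd = \<nu>}"

definition cost2 :: "('a::euclidean_space \<times> 'a) measure \<Rightarrow> ennreal" where
  "cost2 \<gamma> = (\<integral>\<^sup>+ p. ennreal ((norm (fst p - snd p))\<^sup>2) \<partial>\<gamma>)"

definition W2sq :: "'a::euclidean_space measure \<Rightarrow> 'a measure \<Rightarrow> ennreal" where
  "W2sq \<mu> \<nu> = (INF \<gamma>\<in>couplings \<mu> \<nu>. cost2 \<gamma>)"

definition W2 :: "'a::euclidean_space measure \<Rightarrow> 'a measure \<Rightarrow> ennreal" where
  "W2 \<mu> \<nu> = (if W2sq \<mu> \<nu> = \<infinity> then \<infinity> else ennreal (sqrt (enn2real (W2sq \<mu> \<nu>))))"

definition optimal_couplings :: "'a::euclidean_space measure \<Rightarrow> 'a measure \<Rightarrow> ('a \<times> 'a) measure set" where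
  "optimal_couplings \<mu> \<nu> = {\<gamma>\<in>couplings \<mu> \<nu>. cost2 \<gamma> = W2sq \<mu> \<nu>}"

definition P2 :: "'a::euclidean_space measure \<Rightarrow> 'a measure set" where
  "P2 \<omega>0 = {\<mu>\<in>Pm. W2 \<mu> \<omega>0 < \<infinity>}"

definition transport_plans :: "'a::euclidean_space measure \<Rightarrow> 'a measure \<Rightarrow> 'a measure \<Rightarrow> ('a \<times> 'a \<times> 'a) measure set" where
  "transport_plans \<omega> \<mu>0 \<mu>1 = {w. prob_space w \<and> sets w = sets borel \<and>
      distr w borel (\<lambda>(x1,x2,x3). (x1,x2)) \<in> optimal_couplings \<omega> \<mu>0 \<and>
      distr w borel (\<lambda>(x1,x2,x3). (x1,x3)) \<in> optimal_couplings \<omega> \<mu>1}"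

definition gen_geod :: "('a::euclidean_space \<times> 'a \<times> 'a) measure \<Rightarrow> real \<Rightarrow> 'a measure" where
  "gen_geod w \<alpha> = distr w borel (\<lambda>(x1,x2,x3). (1 - \<alpha>) *\<^sub>R x2 + \<alpha> *\<^sub>R x3)"

definition W2plan_sq :: "('a::euclidean_space \<times> 'a \<times> 'a) measure \<Rightarrow> ennreal" where
  "W2plan_sq w = (\<integral>\<^sup>+ p. ennreal ((norm (fst (snd p) - snd (snd p)))\<^sup>2) \<partial>w)"

definition proper_fun :: "'a::euclidean_space measure \<Rightarrow> ('a measure \<Rightarrow> ereal) \<Rightarrow> bool" where
  "proper_fun \<omega>0 E \<longleftrightarrow> (\<exists>\<mu>\<in>P2 \<omega>0. E \<mu> < \<infinity>)"

definition coercive :: "'a::euclidean_space measure \<Rightarrow> ('a measure \<Rightarrow> ereal) \<Rightarrow> bool" where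
  "coercive \<omega>0 E \<longleftrightarrow> (\<exists>\<tau>0>0. \<exists>u0\<in>P2 \<omega>0.
      (INF v\<in>P2 \<omega>0. ereal (1 / (2 * \<tau>0)) * enn2ereal (W2sq u0 v) + E v) > - \<infinity>)"

definition W2_lsc :: "'a::euclidean_space measure \<Rightarrow> ('a measure \<Rightarrow> ereal) \<Rightarrow> bool" where
  "W2_lsc \<omega>0 E \<longleftrightarrow> (\<forall>\<mu>s \<mu>. (\<forall>n. \<mu>s n \<in> P2 \<omega>0) \<and> \<mu> \<in> P2 \<omega>0 \<and>
      (\<lambda>n. W2 (\<mu>s n) \<mu>) \<longlonglongrightarrow> 0 \<longrightarrow> E \<mu> \<le> liminf (\<lambda>n. E (\<mu>s n)))"

definition lambda_convex_gg :: "'a::euclidean_space measure \<Rightarrow> ('a measure \<Rightarrow> ereal) \<Rightarrow> real \<Rightarrow> bool" where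
  "lambda_convex_gg \<omega>0 E lam \<longleftrightarrow>
     (\<forall>\<mu>0\<in>P2 \<omega>0. \<forall>\<mu>1\<in>P2 \<omega>0. \<forall>\<omega>\<in>P2 \<omega>0. \<exists>w\<in>transport_plans \<omega> \<mu>0 \<mu>1.
        \<forall>\<alpha>\<in>{0..1}. E (gen_geod w \<alpha>) \<le>
          ereal (1 - \<alpha>) * E \<mu>0 + ereal \<alpha> * E \<mu>1
          - ereal (\<alpha> * (1 - \<alpha>) * lam / 2) * enn2ereal (W2plan_sq w))"

definition Jstep :: "'a::euclidean_space measure \<Rightarrow> ('a measure \<Rightarrow> ereal) \<Rightarrow> real \<Rightarrow> 'a measure \<Rightarrow> 'a measure" where
  "Jstep \<omega>0 E \<tau> \<mu> = (SOME \<nu>. \<nu> \<in> P2 \<omega>0 \<and>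
      (\<forall>\<nu>'\<in>P2 \<omega>0. ereal (1 / (2 * \<tau>)) * enn2ereal (W2sq \<mu> \<nu>) + E \<nu>
                   \<le> ereal (1 / (2 * \<tau>)) * enn2ereal (W2sq \<mu> \<nu>') + E \<nu>'))"

definition Sflow :: "'a::euclidean_space measure \<Rightarrow> ('a measure \<Rightarrow> ereal) \<Rightarrow> real \<Rightarrow> 'a measure \<Rightarrow> 'a measure" where
  "Sflow \<omega>0 E t \<mu> = (THE \<nu>. \<nu> \<in> P2 \<omega>0 \<and>
      (\<lambda>n. W2 ((Jstep \<omega>0 E (t / real n) ^^ n) \<mu>) \<nu>) \<longlonglongrightarrow> 0)"

definition slope :: "'a::euclidean_space measure \<Rightarrow> ('a measure \<Rightarrow> ereal) \<Rightarrow> 'a measure \<Rightarrow> ereal" where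
  "slope \<omega>0 E \<mu> = (INF \<delta>\<in>{0::real<..}. sup 0 (SUP \<nu>\<in>{\<nu>\<in>P2 \<omega>0. 0 < W2 \<mu> \<nu> \<and> W2 \<mu> \<nu> < ennreal \<delta>}.
       max 0 (E \<mu> - E \<nu>) / enn2ereal (W2 \<mu> \<nu>)))"

definition disc_flow :: "'a::euclidean_space measure \<Rightarrow> ('a measure \<Rightarrow> ereal) \<Rightarrow> real list \<Rightarrow> 'a measure \<Rightarrow> 'a measure" where
  "disc_flow \<omega>0 E hs \<mu> = foldl (\<lambda>\<nu> h. Jstep \<omega>0 E h \<nu>) \<mu> hs"

definition admissible_steps :: "real \<Rightarrow> real list \<Rightarrow> bool" where
  "admissible_steps t hs \<longleftrightarrow> hs \<noteq> [] \<and> (\<forall>h\<in>set hs. 0 < h) \<and> sum_list hs = t"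

end

theory Submission
  imports Defs
begin

text \<open>
  Couplings with matching marginals can be glued up to an arbitrarily small error by conditioning on the
  cells of a countable Borel partition, and a Markov chain glues a whole sequence of them. This realizes a
  chain of measures with prescribed \<open>W\<^sub>2\<close> steps by random variables with nearly the same \<open>L\<^sup>2\<close> steps. The
  triangle inequality follows, and almost sure limits make \<open>P2 \<omega>0\<close> a complete metric space, whatever \<open>\<omega>0\<close> is.

  Convexity along generalized geodesics with base \<open>x\<close> makes \<open>v \<mapsto> W\<^sub>2(x,v)\<^sup>2/(2h) + E v\<close> uniformly convex,
  so the minimizer \<open>y = J\<^sub>h x\<close> exists and satisfies, with \<open>a = \<lambda>\<^sup>-\<close>, the variational inequality
  \<open>(1 - a h) W\<^sub>2(y,v)\<^sup>2 - W\<^sub>2(x,v)\<^sup>2 + W\<^sub>2(x,y)\<^sup>2 \<le> 2 h (E v - E y)\<close>.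
  For two discrete flows \<open>x\<^sub>i, y\<^sub>j\<close> with steps \<open>h, k\<close>, add \<open>k\<close> times the inequality for \<open>x\<^sub>i\<close> tested
  with \<open>y\<^sub>j\<close> to \<open>h\<close> times the one for \<open>y\<^sub>j\<close> tested with \<open>x\<^sub>i\<close>. The energies cancel and the squared distances
  \<open>D\<^sub>i\<^sub>j\<close> obey the Crandall-Liggett-Kobayashi recursion
  \<open>(h + k - 2 a h k) D\<^sub>i\<^sub>j \<le> k D\<^sub>i\<^sub>-\<^sub>1\<^sub>j + h D\<^sub>i\<^sub>j\<^sub>-\<^sub>1\<close>. The slope at \<open>\<mu>\<close> controls the boundary values, and a
  supersolution gives \<open>D\<^sub>i\<^sub>j \<le> |\<partial>E|(\<mu>)\<^sup>2 ((t - s)\<^sup>2 + |h| t + |k| s) exp (4 a (t + s))\<close>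
  at times \<open>t\<close> and \<open>s\<close>. At \<open>s = t\<close> this shows that \<open>J\<^sub>t\<^sub>/\<^sub>n\<^sup>n \<mu>\<close> is Cauchy and bounds the distance of
  its limit to any discrete flow by \<open>|\<partial>E|(\<mu>) sqrt (|h| t) exp (4 a t)\<close>.
\<close>

section \<open>Gluing of couplings\<close>

lemma countable_Borel_partition:
  fixes \<epsilon> :: real
  assumes "\<epsilon> > 0"
  obtains c :: "'a::{metric_space, second_countable_topology} \<Rightarrow> nat"
  where "c \<in> borel \<rightarrow>\<^sub>M count_space UNIV" "\<And>x y. c x = c y \<Longrightarrow> dist x y < \<epsilon>"
proof -
  obtain S :: "'a set" where S: "countable S" "\<And>U. open U \<Longrightarrow> U \<noteq> {} \<Longrightarrow> \<exists>s\<in>S. s \<in> U"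
    using countable_dense_setE by metis
  define c where "c x = (LEAST n. dist (from_nat_into S n) x < \<epsilon> / 2)" for x
  have near: "dist (from_nat_into S (c x)) x < \<epsilon> / 2" for x
  proof -
    obtain s where "s \<in> S" "dist s x < \<epsilon> / 2"
      using S(2)[of "ball x (\<epsilon> / 2)"] \<open>\<epsilon> > 0\<close> by (auto simp: dist_commute)
    then have "\<exists>n. dist (from_nat_into S n) x < \<epsilon> / 2"
      using from_nat_into_surj[OF S(1)] by metis
    then show ?thesis unfolding c_def by (rule LeastI_ex)
  qed
  show ?thesis
  proof
    show "c \<in> borel \<rightarrow>\<^sub>M count_space UNIV" unfolding c_def by measurable
    show "dist x y < \<epsilon>" if "c x = c y" for x y
      using near[of x] near[of y] that by (simp add: dist_triangle_half_r)
  qed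
qed

text \<open>On a null fibre the conditional measure is undefined; the value \<open>N\<close> keeps it a probability.\<close>

definition fibre_measure :: "'b measure \<Rightarrow> ('b \<Rightarrow> nat) \<Rightarrow> nat \<Rightarrow> 'b measure" where
  "fibre_measure N c n = (if emeasure N (c -` {n} \<inter> space N) = 0 then N
    else uniform_measure N (c -` {n} \<inter> space N))"

lemma sets_fibre_measure [simp]: "sets (fibre_measure N c n) = sets N"
  by (simp add: fibre_measure_def)

lemma (in prob_space) fibre_measure_measurable:
  "fibre_measure M c \<in> count_space UNIV \<rightarrow>\<^sub>M prob_algebra M"
proof -
  have "prob_space (fibre_measure M c n)" for n
    by (auto simp: fibre_measure_def prob_space_axioms intro!: prob_space_uniform_measure)
  then show ?thesis by (simp add: space_prob_algebra)
qed

lemma (in prob_space) emeasure_fibre_measure: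
  assumes c[measurable]: "c \<in> M \<rightarrow>\<^sub>M count_space UNIV" and A: "A \<in> events"
  shows "emeasure (fibre_measure M c n) A * emeasure M (c -` {n} \<inter> space M) =
    emeasure M (A \<inter> (c -` {n} \<inter> space M))"
proof -
  define B where "B = c -` {n} \<inter> space M"
  have B: "B \<in> events" unfolding B_def by measurable
  have "emeasure M (A \<inter> B) \<le> emeasure M B" using B by (intro emeasure_mono) auto
  then have "emeasure (fibre_measure M c n) A * emeasure M B = emeasure M (A \<inter> B)"
    using A B unfolding fibre_measure_def B_def[symmetric]
    by (cases "emeasure M B = 0") (simp_all add: Int_commute ennreal_divide_times flip: less_top)
  then show ?thesis by (simp add: B_def)
qed

lemma (in prob_space) bind_fibre_measure:
  assumes c[measurable]: "c \<in> M \<rightarrow>\<^sub>M count_space UNIV"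
  shows "M \<bind> (\<lambda>z. fibre_measure M c (c z)) = M"
proof (rule measure_eqI)
  define B where "B n = c -` {n} \<inter> space M" for n
  have B[measurable]: "B n \<in> events" for n unfolding B_def by measurable
  have kernel: "(\<lambda>z. fibre_measure M c (c z)) \<in> M \<rightarrow>\<^sub>M subprob_algebra M"
    by (intro measurable_prob_algebraD measurable_compose[OF c fibre_measure_measurable])
  show sets: "sets (M \<bind> (\<lambda>z. fibre_measure M c (c z))) = events"
    by (intro sets_bind not_empty) simp
  fix A assume "A \<in> sets (M \<bind> (\<lambda>z. fibre_measure M c (c z)))"
  then have A[measurable]: "A \<in> events" by (simp add: sets)
  have "emeasure (M \<bind> (\<lambda>z. fibre_measure M c (c z))) A = (\<integral>\<^sup>+ z. emeasure (fibre_measure M c (c z)) A \<partial>M)"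
    by (rule emeasure_bind[OF not_empty kernel A])
  also have "\<dots> = (\<integral>\<^sup>+ z. (\<Sum>n. emeasure (fibre_measure M c n) A * indicator (B n) z) \<partial>M)"
  proof (rule nn_integral_cong)
    fix z assume "z \<in> space M"
    then have "(\<lambda>n. emeasure (fibre_measure M c n) A * indicator (B n) z) =
        (\<lambda>n. if n \<in> {c z} then emeasure (fibre_measure M c n) A else 0)"
      by (auto simp: B_def indicator_def fun_eq_iff)
    then show "emeasure (fibre_measure M c (c z)) A =
        (\<Sum>n. emeasure (fibre_measure M c n) A * indicator (B n) z)"
      using sums_unique[OF sums_If_finite_set[of "{c z}" "\<lambda>n. emeasure (fibre_measure M c n) A"]] by simp
  qed
  also have "\<dots> = (\<Sum>n. emeasure M (A \<inter> B n))"
    by (subst nn_integral_suminf)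
      (simp_all add: nn_integral_cmult_indicator emeasure_fibre_measure[OF c A, folded B_def])
  also have "\<dots> = emeasure M (\<Union>n. A \<inter> B n)"
    by (rule suminf_emeasure) (auto simp: disjoint_family_on_def B_def)
  also have "(\<Union>n. A \<inter> B n) = A"
    using sets.sets_into_space[OF A] by (auto simp: B_def)
  finally show "emeasure (M \<bind> (\<lambda>z. fibre_measure M c (c z))) A = emeasure M A" .
qed

lemma AE_fibre_not_null:
  fixes c :: "'b \<Rightarrow> nat"
  assumes [measurable]: "c \<in> N \<rightarrow>\<^sub>M count_space UNIV"
  shows "AE z in N. emeasure N (c -` {c z} \<inter> space N) \<noteq> 0"
proof -
  have "AE z in N. emeasure N (c -` {n} \<inter> space N) = 0 \<longrightarrow> c z \<noteq> n" for n
  proof (cases "emeasure N (c -` {n} \<inter> space N) = 0")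
    case True
    then have "c -` {n} \<inter> space N \<in> null_sets N" by (intro null_setsI) measurable
    then show ?thesis by (rule AE_I') auto
  qed simp
  then have "AE z in N. \<forall>n. emeasure N (c -` {n} \<inter> space N) = 0 \<longrightarrow> c z \<noteq> n"
    by (simp add: AE_all_countable)
  then show ?thesis by eventually_elim blast
qed

lemma AE_fibre_measure:
  assumes "c \<in> N \<rightarrow>\<^sub>M count_space UNIV" and "emeasure N (c -` {n} \<inter> space N) \<noteq> 0"
  shows "AE z in fibre_measure N c n. c z = n"
proof -
  have "fibre_measure N c n = uniform_measure N (c -` {n} \<inter> space N)"
    using assms(2) unfolding fibre_measure_def by (rule if_not_P)
  moreover have "AE z in uniform_measure N (c -` {n} \<inter> space N). c z = n"
    by (rule AE_uniform_measureI[OF measurable_sets[OF assms(1)]]) simp_all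
  ultimately show ?thesis by (rule ssubst)
qed

text \<open>A substitute for the disintegration theorem: condition on the countably many fibres of a
  discretization of \<open>X\<close>.\<close>

lemma approximate_disintegration:
  fixes X :: "'b \<Rightarrow> 'a::{metric_space, second_countable_topology}" and \<epsilon> :: real
  assumes "prob_space N" and X[measurable]: "X \<in> borel_measurable N" and "\<epsilon> > 0"
  obtains \<kappa> where "\<kappa> \<in> borel \<rightarrow>\<^sub>M prob_algebra N" "distr N borel X \<bind> \<kappa> = N"
    "AE x in distr N borel X. AE z in \<kappa> x. dist x (X z) < \<epsilon>"
proof -
  interpret N: prob_space N by fact
  obtain c :: "'a \<Rightarrow> nat" where c[measurable]: "c \<in> borel \<rightarrow>\<^sub>M count_space UNIV"
    and close: "\<And>x y. c x = c y \<Longrightarrow> dist x y < \<epsilon>"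
    using countable_Borel_partition[OF \<open>\<epsilon> > 0\<close>] by blast
  have cX: "(\<lambda>z. c (X z)) \<in> N \<rightarrow>\<^sub>M count_space UNIV" by measurable
  define \<kappa> where "\<kappa> x = fibre_measure N (\<lambda>z. c (X z)) (c x)" for x
  show ?thesis
  proof
    show \<kappa>: "\<kappa> \<in> borel \<rightarrow>\<^sub>M prob_algebra N"
      unfolding \<kappa>_def by (rule measurable_compose[OF c N.fibre_measure_measurable])
    show "distr N borel X \<bind> \<kappa> = N"
      using bind_distr[OF X measurable_prob_algebraD[OF \<kappa>] N.not_empty] N.bind_fibre_measure[OF cX]
      by (simp add: \<kappa>_def)
    have "AE x in distr N borel X. emeasure (distr N borel X) (c -` {c x} \<inter> space (distr N borel X)) \<noteq> 0"
      by (rule AE_fibre_not_null) measurable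
    then show "AE x in distr N borel X. AE z in \<kappa> x. dist x (X z) < \<epsilon>"
    proof eventually_elim
      case (elim x)
      have "c -` {c x} \<in> sets borel" using measurable_sets[OF c, of "{c x}"] by simp
      then have "emeasure N ((\<lambda>z. c (X z)) -` {c x} \<inter> space N) \<noteq> 0"
        using elim by (simp add: emeasure_distr vimage_def)
      from AE_fibre_measure[OF cX this] show ?case
        unfolding \<kappa>_def by (rule eventually_mono) (auto intro: close)
    qed
  qed
qed

lemma (in Ionescu_Tulcea) distr_lim_restrict:
  "distr PF.lim (PiM {0..<n} M) (\<lambda>\<omega>. restrict \<omega> {0..<n}) = C 0 n (\<lambda>_. undefined)"
proof -
  have "emeasure (CI {0..<n}) A = emeasure (C 0 n (\<lambda>_. undefined)) A" if "A \<in> sets (PiM {0..<n} M)" for A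
  proof -
    have "PF.emb {0..<n} {0..<n} A = A"
      using sets.sets_into_space[OF that] by (intro prod_emb_id) (simp add: space_PiM)
    then show ?thesis using emeasure_CI[of "{0..<n}" n A] that by simp
  qed
  then have "CI {0..<n} = C 0 n (\<lambda>_. undefined)"
    by (intro measure_eqI) (simp_all add: CI_def sets_C)
  then show ?thesis using distr_lim[of "{0..<n}"] by simp
qed

lemma (in Ionescu_Tulcea) prob_space_lim: "prob_space PF.lim"
proof (rule prob_space_distrD)
  show "(\<lambda>\<omega>. restrict \<omega> {0..<0}) \<in> PF.lim \<rightarrow>\<^sub>M PiM {0..<0} M"
    by (simp add: measurable_cong_sets[OF PF.sets_lim refl])
  show "prob_space (distr PF.lim (PiM {0..<0} M) (\<lambda>\<omega>. restrict \<omega> {0..<0}))"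
    unfolding distr_lim_restrict by (rule prob_space_C) simp
qed

lemma (in Ionescu_Tulcea) distr_lim_Suc:
  assumes f: "f \<in> PiM {0..<Suc n} M \<rightarrow>\<^sub>M R"
  shows "distr PF.lim R (\<lambda>\<omega>. f (restrict \<omega> {0..<Suc n})) =
    PF.lim \<bind> (\<lambda>\<omega>. distr (P n (restrict \<omega> {0..<n})) R (\<lambda>y. f (fun_upd (restrict \<omega> {0..<n}) n y)))"
proof -
  define past where "past n \<omega> = restrict \<omega> {0..<n}" for n and \<omega> :: "nat \<Rightarrow> 'a"
  have past: "past n \<in> PF.lim \<rightarrow>\<^sub>M PiM {0..<n} M" for n
    by (simp add: past_def[abs_def] measurable_cong_sets[OF PF.sets_lim refl] measurable_restrict_subset)
  have C: "C 0 n (\<lambda>_. undefined) = distr PF.lim (PiM {0..<n} M) (past n)" for n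
    by (simp add: past_def[abs_def] distr_lim_restrict)
  have nonempty: "space PF.lim \<noteq> {}" using prob_space_lim by (rule prob_space.not_empty)
  have kernel: "(\<lambda>\<omega>. distr (eP n \<omega>) R f) \<in> PiM {0..<n} M \<rightarrow>\<^sub>M subprob_algebra R"
    by (rule measurable_compose[OF measurable_eP measurable_distr[OF f]])
  have "distr PF.lim R (\<lambda>\<omega>. f (past (Suc n) \<omega>)) = distr (C 0 (Suc n) (\<lambda>_. undefined)) R f"
    unfolding C using f past by (simp add: distr_distr comp_def)
  also have "\<dots> = C 0 n (\<lambda>_. undefined) \<bind> (\<lambda>\<omega>. distr (eP n \<omega>) R f)"
    using distr_bind[OF _ _ f, of "eP n" "C 0 n (\<lambda>_. undefined)"] nonempty
    by (simp add: C)
  also have "\<dots> = PF.lim \<bind> (\<lambda>\<omega>. distr (eP n (past n \<omega>)) R f)"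
    unfolding C by (rule bind_distr[OF past kernel nonempty])
  also have "\<dots> = PF.lim \<bind> (\<lambda>\<omega>. distr (P n (past n \<omega>)) R (\<lambda>y. f (fun_upd (past n \<omega>) n y)))"
  proof (intro bind_cong refl)
    fix \<omega> assume "\<omega> \<in> space PF.lim"
    then have \<omega>: "past n \<omega> \<in> space (PiM {0..<n} M)" by (rule measurable_space[OF past])
    then have "fun_upd (past n \<omega>) n \<in> P n (past n \<omega>) \<rightarrow>\<^sub>M PiM {0..<Suc n} M"
      by (intro measurable_fun_upd[where J = "{0..<n}"]) (auto simp: sets_P)
    then show "distr (eP n (past n \<omega>)) R f = distr (P n (past n \<omega>)) R (\<lambda>y. f (fun_upd (past n \<omega>) n y))"
      using f by (simp add: eP_def distr_distr comp_def)
  qed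
  finally show ?thesis by (simp add: past_def)
qed

locale Markov_chain =
  fixes N :: "'a measure" and \<nu>\<^sub>0 :: "'a measure" and K :: "nat \<Rightarrow> 'a \<Rightarrow> 'a measure"
  assumes initial: "\<nu>\<^sub>0 \<in> space (prob_algebra N)" and kernel[measurable]: "\<And>n. K n \<in> N \<rightarrow>\<^sub>M prob_algebra N"
begin

definition past_kernel :: "nat \<Rightarrow> (nat \<Rightarrow> 'a) \<Rightarrow> 'a measure" where
  "past_kernel n \<omega> = (case n of 0 \<Rightarrow> \<nu>\<^sub>0 | Suc m \<Rightarrow> K m (\<omega> m))"

lemma past_kernel_measurable: "past_kernel n \<in> PiM {0..<n} (\<lambda>_. N) \<rightarrow>\<^sub>M prob_algebra N"
  unfolding past_kernel_def using initial by (cases n) auto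

sublocale Ionescu_Tulcea past_kernel "\<lambda>_. N"
proof (rule Ionescu_Tulcea.intro)
  show "past_kernel n \<in> PiM {0..<n} (\<lambda>_. N) \<rightarrow>\<^sub>M subprob_algebra N" for n
    by (intro measurable_prob_algebraD past_kernel_measurable)
  show "prob_space (past_kernel n \<omega>)" if "\<omega> \<in> space (PiM {0..<n} (\<lambda>_. N))" for n \<omega>
    using measurable_space[OF past_kernel_measurable that] by (simp add: space_prob_algebra)
qed

lemma coordinate_measurable: "(\<lambda>\<omega>. \<omega> n) \<in> PF.lim \<rightarrow>\<^sub>M N"
  by (simp add: measurable_cong_sets[OF PF.sets_lim refl])

lemma distr_transition:
  assumes [measurable]: "(\<lambda>(x, y). g x y) \<in> N \<Otimes>\<^sub>M N \<rightarrow>\<^sub>M R"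
  shows "distr PF.lim R (\<lambda>\<omega>. g (\<omega> n) (\<omega> (Suc n))) =
    distr PF.lim N (\<lambda>\<omega>. \<omega> n) \<bind> (\<lambda>x. distr (K n x) R (g x))"
proof -
  have "(\<lambda>x. distr (K n x) R (g x)) \<in> N \<rightarrow>\<^sub>M subprob_algebra R"
    by (intro measurable_prob_algebraD) measurable
  then have "distr PF.lim N (\<lambda>\<omega>. \<omega> n) \<bind> (\<lambda>x. distr (K n x) R (g x)) =
      PF.lim \<bind> (\<lambda>\<omega>. distr (K n (\<omega> n)) R (g (\<omega> n)))"
    by (rule bind_distr[OF coordinate_measurable _ prob_space.not_empty[OF prob_space_lim]])
  then show ?thesis
    using distr_lim_Suc[of "\<lambda>\<omega>. g (\<omega> n) (\<omega> (Suc n))" "Suc n" R] by (simp add: past_kernel_def)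
qed

lemma distr_coordinate_0: "distr PF.lim N (\<lambda>\<omega>. \<omega> 0) = \<nu>\<^sub>0"
proof -
  have \<nu>\<^sub>0: "prob_space \<nu>\<^sub>0" "sets \<nu>\<^sub>0 = sets N" using initial by (auto simp: space_prob_algebra)
  have "distr PF.lim N (\<lambda>\<omega>. \<omega> 0) = PF.lim \<bind> (\<lambda>\<omega>. \<nu>\<^sub>0)"
    using distr_lim_Suc[of "\<lambda>\<omega>. \<omega> 0" 0 N] \<nu>\<^sub>0 by (simp add: past_kernel_def distr_id2)
  then show ?thesis using \<nu>\<^sub>0 by (simp add: bind_const' prob_space_lim prob_space_imp_subprob_space)
qed

lemma distr_coordinate_Suc: "distr PF.lim N (\<lambda>\<omega>. \<omega> (Suc n)) = distr PF.lim N (\<lambda>\<omega>. \<omega> n) \<bind> K n"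
proof -
  have "distr (K n x) N (\<lambda>y. y) = K n x" if "x \<in> space N" for x
    using measurable_space[OF kernel that] by (simp add: space_prob_algebra distr_id2)
  then have "distr PF.lim N (\<lambda>\<omega>. \<omega> n) \<bind> (\<lambda>x. distr (K n x) N (\<lambda>y. y)) = distr PF.lim N (\<lambda>\<omega>. \<omega> n) \<bind> K n"
    by (intro bind_cong) auto
  then show ?thesis using distr_transition[of "\<lambda>_ y. y" N n] by simp
qed

end

lemma Markov_chain_exists:
  fixes K :: "nat \<Rightarrow> 'a \<Rightarrow> 'a measure" and \<nu> :: "nat \<Rightarrow> 'a measure"
  assumes "\<nu> 0 \<in> space (prob_algebra N)" "\<And>n. K n \<in> N \<rightarrow>\<^sub>M prob_algebra N"
    and \<nu>_Suc: "\<And>n. \<nu> (Suc n) = \<nu> n \<bind> K n"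
  obtains \<Omega> :: "(nat \<Rightarrow> 'a) measure" and Z where
    "prob_space \<Omega>" "\<And>n. Z n \<in> \<Omega> \<rightarrow>\<^sub>M N" "\<And>n. distr \<Omega> N (Z n) = \<nu> n"
    "\<And>n. distr \<Omega> (N \<Otimes>\<^sub>M N) (\<lambda>\<omega>. (Z n \<omega>, Z (Suc n) \<omega>)) =
      \<nu> n \<bind> (\<lambda>x. distr (K n x) (N \<Otimes>\<^sub>M N) (Pair x))"
proof -
  interpret Markov_chain N "\<nu> 0" K using assms by unfold_locales
  have marginal: "distr PF.lim N (\<lambda>\<omega>. \<omega> n) = \<nu> n" for n
    by (induction n) (simp_all add: distr_coordinate_0 distr_coordinate_Suc \<nu>_Suc)
  show ?thesis
  proof (rule that[of PF.lim "\<lambda>n \<omega>. \<omega> n"])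
    show "distr PF.lim (N \<Otimes>\<^sub>M N) (\<lambda>\<omega>. (\<omega> n, \<omega> (Suc n))) =
        \<nu> n \<bind> (\<lambda>x. distr (K n x) (N \<Otimes>\<^sub>M N) (Pair x))" for n
      using distr_transition[of Pair "N \<Otimes>\<^sub>M N" n] by (simp add: marginal)
  qed (rule prob_space_lim coordinate_measurable marginal)+
qed

lemma AE_bind_distr_Pair:
  assumes K[measurable]: "K \<in> M \<rightarrow>\<^sub>M prob_algebra N" and R[measurable]: "Measurable.pred (M \<Otimes>\<^sub>M N) R"
    and \<nu>[measurable_cong]: "sets \<nu> = sets M"
  shows "(AE p in \<nu> \<bind> (\<lambda>x. distr (K x) (M \<Otimes>\<^sub>M N) (Pair x)). R p) \<longleftrightarrow> (AE x in \<nu>. AE y in K x. R (x, y))"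
proof -
  have "(\<lambda>x. distr (K x) (M \<Otimes>\<^sub>M N) (Pair x)) \<in> \<nu> \<rightarrow>\<^sub>M subprob_algebra (M \<Otimes>\<^sub>M N)"
    by (intro measurable_prob_algebraD) measurable
  then have "(AE p in \<nu> \<bind> (\<lambda>x. distr (K x) (M \<Otimes>\<^sub>M N) (Pair x)). R p) \<longleftrightarrow>
      (AE x in \<nu>. AE p in distr (K x) (M \<Otimes>\<^sub>M N) (Pair x). R p)"
    using R by (rule AE_bind)
  also have "\<dots> \<longleftrightarrow> (AE x in \<nu>. AE y in K x. R (x, y))"
  proof (intro AE_cong)
    fix x assume "x \<in> space \<nu>"
    then have x: "x \<in> space M" using sets_eq_imp_space_eq[OF \<nu>] by simp
    then have "sets (K x) = sets N" using measurable_space[OF K] by (simp add: space_prob_algebra)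
    then have "Pair x \<in> K x \<rightarrow>\<^sub>M M \<Otimes>\<^sub>M N"
      using measurable_Pair1'[OF x] measurable_cong_sets by blast
    then show "(AE p in distr (K x) (M \<Otimes>\<^sub>M N) (Pair x). R p) \<longleftrightarrow> (AE y in K x. R (x, y))"
      using R by (subst AE_distr_iff) (auto simp: pred_def)
  qed
  finally show ?thesis .
qed

lemma fst_borel_measurable:
  "(fst :: 'a::second_countable_topology \<times> 'b::second_countable_topology \<Rightarrow> 'a) \<in> borel_measurable borel"
  by (simp flip: borel_prod)

lemma snd_borel_measurable:
  "(snd :: 'a::second_countable_topology \<times> 'b::second_countable_topology \<Rightarrow> 'b) \<in> borel_measurable borel"
  by (simp flip: borel_prod)

lemma approximate_gluing_kernel:
  fixes \<gamma> \<gamma>' :: "('a::{metric_space, second_countable_topology} \<times> 'a) measure"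
  assumes \<gamma>: "prob_space \<gamma>" "sets \<gamma> = sets borel" and \<gamma>': "prob_space \<gamma>'" "sets \<gamma>' = sets borel"
    and match: "distr \<gamma> borel snd = distr \<gamma>' borel fst" and "\<epsilon> > 0"
  obtains \<kappa> where "\<kappa> \<in> borel \<rightarrow>\<^sub>M prob_algebra borel" "\<gamma> \<bind> \<kappa> = \<gamma>'"
    "AE z in \<gamma>. AE z' in \<kappa> z. dist (snd z) (fst z') < \<epsilon>"
proof -
  have snd: "snd \<in> borel_measurable \<gamma>" and fst: "fst \<in> borel_measurable \<gamma>'"
    using fst_borel_measurable snd_borel_measurable measurable_cong_sets \<gamma> \<gamma>' by blast+
  obtain \<kappa> where "\<kappa> \<in> borel \<rightarrow>\<^sub>M prob_algebra \<gamma>'"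
    and bind: "distr \<gamma>' borel fst \<bind> \<kappa> = \<gamma>'"
    and near: "AE x in distr \<gamma>' borel fst. AE z' in \<kappa> x. dist x (fst z') < \<epsilon>"
    by (rule approximate_disintegration[OF \<gamma>'(1) fst \<open>\<epsilon> > 0\<close>])
  moreover have "prob_algebra \<gamma>' = prob_algebra borel"
    by (simp add: prob_algebra_def \<gamma>' cong: subprob_algebra_cong)
  ultimately have \<kappa>: "\<kappa> \<in> borel \<rightarrow>\<^sub>M prob_algebra borel" by simp
  show ?thesis
  proof
    show "(\<lambda>z :: 'a \<times> 'a. \<kappa> (snd z)) \<in> borel \<rightarrow>\<^sub>M prob_algebra borel"
      by (rule measurable_compose[OF snd_borel_measurable \<kappa>])
    show "\<gamma> \<bind> (\<lambda>z. \<kappa> (snd z)) = \<gamma>'"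
      using bind_distr[OF snd measurable_prob_algebraD[OF \<kappa>] prob_space.not_empty[OF \<gamma>(1)]] bind match
      by simp
    show "AE z in \<gamma>. AE z' in \<kappa> (snd z). dist (snd z) (fst z') < \<epsilon>"
      by (rule AE_distrD[OF snd near[folded match]])
  qed
qed

lemma approximate_gluing:
  fixes \<gamma> :: "nat \<Rightarrow> ('a::{metric_space, second_countable_topology} \<times> 'a) measure" and \<epsilon> :: "nat \<Rightarrow> real"
  assumes \<gamma>: "\<And>n. prob_space (\<gamma> n)" "\<And>n. sets (\<gamma> n) = sets borel"
    and match: "\<And>n. distr (\<gamma> n) borel snd = distr (\<gamma> (Suc n)) borel fst" and \<epsilon>: "\<And>n. \<epsilon> n > 0"
  obtains \<Omega> :: "(nat \<Rightarrow> 'a \<times> 'a) measure" and Z where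
    "prob_space \<Omega>" "\<And>n. Z n \<in> borel_measurable \<Omega>" "\<And>n. distr \<Omega> borel (Z n) = \<gamma> n"
    "\<And>n. AE \<omega> in \<Omega>. dist (snd (Z n \<omega>)) (fst (Z (Suc n) \<omega>)) < \<epsilon> n"
proof -
  have "\<forall>n. \<exists>\<kappa>. \<kappa> \<in> borel \<rightarrow>\<^sub>M prob_algebra borel \<and> \<gamma> n \<bind> \<kappa> = \<gamma> (Suc n) \<and>
      (AE z in \<gamma> n. AE z' in \<kappa> z. dist (snd z) (fst z') < \<epsilon> n)"
    using approximate_gluing_kernel[OF \<gamma> \<gamma> match \<epsilon>] by blast
  from choice[OF this] obtain \<kappa> where \<kappa>_all: "\<forall>n. \<kappa> n \<in> borel \<rightarrow>\<^sub>M prob_algebra borel \<and>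
      \<gamma> n \<bind> \<kappa> n = \<gamma> (Suc n) \<and>
      (AE z in \<gamma> n. AE z' in \<kappa> n z. dist (snd z) (fst z') < \<epsilon> n)" ..
  then have \<kappa>: "\<And>n. \<kappa> n \<in> borel \<rightarrow>\<^sub>M prob_algebra borel" "\<And>n. \<gamma> (Suc n) = \<gamma> n \<bind> \<kappa> n"
    and near: "\<And>n. AE z in \<gamma> n. AE z' in \<kappa> n z. dist (snd z) (fst z') < \<epsilon> n"
    by simp_all
  have initial: "\<gamma> 0 \<in> space (prob_algebra borel)" by (simp add: space_prob_algebra \<gamma>)
  obtain \<Omega> :: "(nat \<Rightarrow> 'a \<times> 'a) measure" and Z where \<Omega>: "prob_space \<Omega>"
    and Z: "\<And>n. Z n \<in> borel_measurable \<Omega>" "\<And>n. distr \<Omega> borel (Z n) = \<gamma> n"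
    and law: "\<And>n. distr \<Omega> (borel \<Otimes>\<^sub>M borel) (\<lambda>\<omega>. (Z n \<omega>, Z (Suc n) \<omega>)) =
      \<gamma> n \<bind> (\<lambda>z. distr (\<kappa> n z) (borel \<Otimes>\<^sub>M borel) (Pair z))"
    by (rule Markov_chain_exists[OF initial \<kappa>]) (rule that)
  have "AE \<omega> in \<Omega>. dist (snd (Z n \<omega>)) (fst (Z (Suc n) \<omega>)) < \<epsilon> n" for n
  proof -
    note [measurable] = fst_borel_measurable snd_borel_measurable
    have "Measurable.pred (borel \<Otimes>\<^sub>M borel)
        (\<lambda>p :: ('a \<times> 'a) \<times> 'a \<times> 'a. dist (snd (fst p)) (fst (snd p)) < \<epsilon> n)"
      by measurable
    from AE_bind_distr_Pair[OF \<kappa>(1)[of n] this \<gamma>(2)[of n]] near[of n]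
    have "AE p in distr \<Omega> (borel \<Otimes>\<^sub>M borel) (\<lambda>\<omega>. (Z n \<omega>, Z (Suc n) \<omega>)).
        dist (snd (fst p)) (fst (snd p)) < \<epsilon> n"
      by (simp only: law fst_conv snd_conv)
    from AE_distrD[OF measurable_Pair[OF Z(1) Z(1)] this] show ?thesis by simp
  qed
  then show ?thesis using that \<Omega> Z by blast
qed

section \<open>Square-integrable random variables\<close>

definition mean_square :: "'b measure \<Rightarrow> ('b \<Rightarrow> 'a::real_normed_vector) \<Rightarrow> ennreal" where
  "mean_square M f = (\<integral>\<^sup>+ \<omega>. ennreal ((norm (f \<omega>))\<^sup>2) \<partial>M)"

lemma mean_square_minus_commute: "mean_square M (\<lambda>\<omega>. f \<omega> - g \<omega>) = mean_square M (\<lambda>\<omega>. g \<omega> - f \<omega>)"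
  by (simp add: mean_square_def norm_minus_commute)

lemma mean_square_distr:
  "g \<in> M \<rightarrow>\<^sub>M N \<Longrightarrow> f \<in> borel_measurable N \<Longrightarrow> mean_square (distr M N g) f = mean_square M (\<lambda>\<omega>. f (g \<omega>))"
  by (simp add: mean_square_def nn_integral_distr)

lemma (in prob_space) mean_square_le_const:
  assumes "AE \<omega> in M. norm (f \<omega>) \<le> c"
  shows "mean_square M f \<le> ennreal (c\<^sup>2)"
proof -
  have "mean_square M f \<le> (\<integral>\<^sup>+ \<omega>. ennreal (c\<^sup>2) \<partial>M)"
    unfolding mean_square_def using assms
    by (intro nn_integral_mono_AE) (auto elim!: eventually_mono intro!: ennreal_leI power_mono)
  then show ?thesis by (simp add: emeasure_space_1)
qed

lemma ennreal_power2_le_imp_le: "x\<^sup>2 \<le> ennreal (c\<^sup>2) \<Longrightarrow> 0 \<le> c \<Longrightarrow> x \<le> ennreal c"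
  by (cases x) (auto simp: ennreal_power ennreal_le_iff power2_le_iff_abs_le top_unique)

lemma nn_integral_mult_le_mean_square:
  assumes [measurable]: "f \<in> borel_measurable M" "g \<in> borel_measurable M"
    and "mean_square M f \<le> ennreal (a\<^sup>2)" "mean_square M g \<le> ennreal (b\<^sup>2)" "0 \<le> a" "0 \<le> b"
  shows "(\<integral>\<^sup>+ \<omega>. ennreal (norm (f \<omega>) * norm (g \<omega>)) \<partial>M) \<le> ennreal (a * b)"
proof (rule ennreal_power2_le_imp_le)
  have "(\<integral>\<^sup>+ \<omega>. ennreal (norm (f \<omega>) * norm (g \<omega>)) \<partial>M)\<^sup>2 \<le> mean_square M f * mean_square M g"
    using Cauchy_Schwarz_nn_integral[of "\<lambda>\<omega>. ennreal (norm (f \<omega>))" M "\<lambda>\<omega>. ennreal (norm (g \<omega>))"]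
    by (simp add: mean_square_def ennreal_mult ennreal_power)
  also have "\<dots> \<le> ennreal (a\<^sup>2) * ennreal (b\<^sup>2)"
    using assms by (intro mult_mono) auto
  finally show "(\<integral>\<^sup>+ \<omega>. ennreal (norm (f \<omega>) * norm (g \<omega>)) \<partial>M)\<^sup>2 \<le> ennreal ((a * b)\<^sup>2)"
    by (simp add: power_mult_distrib ennreal_mult)
qed (use assms in auto)

lemma mean_square_add_le:
  fixes f g :: "'b \<Rightarrow> 'a::real_normed_vector"
  assumes [measurable]: "f \<in> borel_measurable M" "g \<in> borel_measurable M"
    and le: "mean_square M f \<le> ennreal (a\<^sup>2)" "mean_square M g \<le> ennreal (b\<^sup>2)" "0 \<le> a" "0 \<le> b"
  shows "mean_square M (\<lambda>\<omega>. f \<omega> + g \<omega>) \<le> ennreal ((a + b)\<^sup>2)"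
proof -
  have "mean_square M (\<lambda>\<omega>. f \<omega> + g \<omega>) \<le> (\<integral>\<^sup>+ \<omega>. ennreal ((norm (f \<omega>))\<^sup>2) + ennreal ((norm (g \<omega>))\<^sup>2) +
      2 * ennreal (norm (f \<omega>) * norm (g \<omega>)) \<partial>M)"
    unfolding mean_square_def
  proof (rule nn_integral_mono)
    fix \<omega>
    have "(norm (f \<omega> + g \<omega>))\<^sup>2 \<le> (norm (f \<omega>) + norm (g \<omega>))\<^sup>2"
      by (intro power_mono norm_triangle_ineq) auto
    also have "\<dots> = (norm (f \<omega>))\<^sup>2 + (norm (g \<omega>))\<^sup>2 + 2 * (norm (f \<omega>) * norm (g \<omega>))"
      by (simp add: power2_sum)
    finally have "(norm (f \<omega> + g \<omega>))\<^sup>2 \<le> (norm (f \<omega>))\<^sup>2 + (norm (g \<omega>))\<^sup>2 + 2 * (norm (f \<omega>) * norm (g \<omega>))" .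
    from ennreal_leI[OF this] show "ennreal ((norm (f \<omega> + g \<omega>))\<^sup>2) \<le>
        ennreal ((norm (f \<omega>))\<^sup>2) + ennreal ((norm (g \<omega>))\<^sup>2) +
        2 * ennreal (norm (f \<omega>) * norm (g \<omega>))"
      by (simp add: ennreal_mult)
  qed
  also have "\<dots> = mean_square M f + mean_square M g + 2 * (\<integral>\<^sup>+ \<omega>. ennreal (norm (f \<omega>) * norm (g \<omega>)) \<partial>M)"
    by (simp add: mean_square_def nn_integral_add nn_integral_cmult)
  also have "\<dots> \<le> ennreal (a\<^sup>2) + ennreal (b\<^sup>2) + 2 * ennreal (a * b)"
    using le by (intro add_mono mult_left_mono nn_integral_mult_le_mean_square) auto
  also have "\<dots> = ennreal ((a + b)\<^sup>2)"
    using le by (simp add: power2_sum ennreal_mult algebra_simps)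
  finally show ?thesis .
qed

lemma mean_square_convex_combination:
  fixes f g h :: "'b \<Rightarrow> 'a::{real_inner, second_countable_topology}"
  assumes [measurable]: "f \<in> borel_measurable M" "g \<in> borel_measurable M" "h \<in> borel_measurable M"
    and \<alpha>: "0 \<le> \<alpha>" "\<alpha> \<le> 1"
  shows "mean_square M (\<lambda>\<omega>. f \<omega> - ((1 - \<alpha>) *\<^sub>R g \<omega> + \<alpha> *\<^sub>R h \<omega>)) +
      ennreal (\<alpha> * (1 - \<alpha>)) * mean_square M (\<lambda>\<omega>. g \<omega> - h \<omega>) =
    ennreal (1 - \<alpha>) * mean_square M (\<lambda>\<omega>. f \<omega> - g \<omega>) + ennreal \<alpha> * mean_square M (\<lambda>\<omega>. f \<omega> - h \<omega>)"
proof -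
  have "(norm (x - ((1 - \<alpha>) *\<^sub>R y + \<alpha> *\<^sub>R z)))\<^sup>2 + \<alpha> * (1 - \<alpha>) * (norm (y - z))\<^sup>2 =
      (1 - \<alpha>) * (norm (x - y))\<^sup>2 + \<alpha> * (norm (x - z))\<^sup>2" for x y z :: 'a
    by (simp add: power2_norm_eq_inner inner_diff_left inner_diff_right inner_add_left inner_add_right
        inner_commute algebra_simps)
  then have "ennreal ((norm (x - ((1 - \<alpha>) *\<^sub>R y + \<alpha> *\<^sub>R z)))\<^sup>2) +
      ennreal (\<alpha> * (1 - \<alpha>)) * ennreal ((norm (y - z))\<^sup>2) =
      ennreal (1 - \<alpha>) * ennreal ((norm (x - y))\<^sup>2) + ennreal \<alpha> * ennreal ((norm (x - z))\<^sup>2)"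
    for x y z :: 'a
    using \<alpha> by (simp flip: ennreal_mult ennreal_plus)
  then show ?thesis
    unfolding mean_square_def by (simp flip: nn_integral_cmult nn_integral_add)
qed

lemma emeasure_norm_ge_le_mean_square:
  assumes [measurable]: "f \<in> borel_measurable M" and "0 < r"
  shows "emeasure M {\<omega> \<in> space M. r \<le> norm (f \<omega>)} \<le> ennreal (1 / r\<^sup>2) * mean_square M f"
proof -
  have "r \<le> norm (f \<omega>) \<longleftrightarrow> 1 \<le> ennreal (1 / r\<^sup>2) * ennreal ((norm (f \<omega>))\<^sup>2)" for \<omega>
  proof -
    have "r \<le> norm (f \<omega>) \<longleftrightarrow> 1 \<le> 1 / r\<^sup>2 * (norm (f \<omega>))\<^sup>2"
      using \<open>0 < r\<close> abs_le_square_iff[of r "norm (f \<omega>)"] by (simp add: field_simps)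
    then show ?thesis by (simp add: ennreal_mult[symmetric] ennreal_le_iff flip: ennreal_1)
  qed
  then have "emeasure M {\<omega> \<in> space M. r \<le> norm (f \<omega>)} \<le>
      ennreal (1 / r\<^sup>2) * (\<integral>\<^sup>+ \<omega>. ennreal ((norm (f \<omega>))\<^sup>2) * indicator (space M) \<omega> \<partial>M)"
    using nn_integral_Markov_inequality[of "\<lambda>\<omega>. ennreal ((norm (f \<omega>))\<^sup>2)"
      "space M" M "ennreal (1 / r\<^sup>2)"] by simp
  also have "(\<integral>\<^sup>+ \<omega>. ennreal ((norm (f \<omega>))\<^sup>2) * indicator (space M) \<omega> \<partial>M) = mean_square M f"
    unfolding mean_square_def by (intro nn_integral_cong) simp
  finally show ?thesis .
qed

lemma emeasure_distr_closed_le_mean_square: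
  fixes f g :: "'b \<Rightarrow> 'a::{real_normed_vector, second_countable_topology}"
  assumes f[measurable]: "f \<in> borel_measurable M" and g[measurable]: "g \<in> borel_measurable M"
    and C: "closed C" and "0 < r"
  shows "emeasure (distr M borel f) C \<le>
    emeasure (distr M borel g) {y. infdist y C \<le> r} + ennreal (1 / r\<^sup>2) * mean_square M (\<lambda>\<omega>. f \<omega> - g \<omega>)"
proof -
  have "(\<lambda>y. infdist y C) \<in> borel_measurable borel"
    by (intro borel_measurable_continuous_onI continuous_intros)
  from measurable_compose[OF g this] have [measurable]: "(\<lambda>\<omega>. infdist (g \<omega>) C) \<in> borel_measurable M" .
  have closed_nbhd: "closed {y. infdist y C \<le> r}" by (intro closed_Collect_le continuous_intros)
  have "emeasure (distr M borel f) C = emeasure M {\<omega> \<in> space M. f \<omega> \<in> C}"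
    using C by (subst emeasure_distr) (auto simp: vimage_def intro!: arg_cong[where f = "emeasure M"])
  also have "\<dots> \<le> emeasure M ({\<omega> \<in> space M. infdist (g \<omega>) C \<le> r} \<union> {\<omega> \<in> space M. r \<le> norm (f \<omega> - g \<omega>)})"
  proof (rule emeasure_mono)
    show "{\<omega> \<in> space M. f \<omega> \<in> C} \<subseteq>
        {\<omega> \<in> space M. infdist (g \<omega>) C \<le> r} \<union> {\<omega> \<in> space M. r \<le> norm (f \<omega> - g \<omega>)}"
    proof
      fix \<omega> assume \<omega>: "\<omega> \<in> {\<omega> \<in> space M. f \<omega> \<in> C}"
      then have "infdist (g \<omega>) C \<le> norm (f \<omega> - g \<omega>)"
        using infdist_le[of "f \<omega>" C "g \<omega>"] by (simp add: dist_norm norm_minus_commute)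
      then show "\<omega> \<in> {\<omega> \<in> space M. infdist (g \<omega>) C \<le> r} \<union> {\<omega> \<in> space M. r \<le> norm (f \<omega> - g \<omega>)}"
        using \<omega> by auto
    qed
  qed measurable
  also have "\<dots> \<le> emeasure M {\<omega> \<in> space M. infdist (g \<omega>) C \<le> r} +
      emeasure M {\<omega> \<in> space M. r \<le> norm (f \<omega> - g \<omega>)}"
    by (rule emeasure_subadditive) measurable
  also have "emeasure M {\<omega> \<in> space M. infdist (g \<omega>) C \<le> r} =
      emeasure (distr M borel g) {y. infdist y C \<le> r}"
    using closed_nbhd by (subst emeasure_distr)
      (auto simp: vimage_def intro!: arg_cong[where f = "emeasure M"])
  also have "emeasure M {\<omega> \<in> space M. r \<le> norm (f \<omega> - g \<omega>)} \<le>
      ennreal (1 / r\<^sup>2) * mean_square M (\<lambda>\<omega>. f \<omega> - g \<omega>)"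
    using \<open>0 < r\<close> by (intro emeasure_norm_ge_le_mean_square) measurable
  finally show ?thesis by (simp add: add_left_mono)
qed

lemma mean_square_telescope_le:
  fixes X :: "nat \<Rightarrow> 'b \<Rightarrow> 'a::{real_normed_vector, second_countable_topology}"
  assumes [measurable]: "\<And>n. X n \<in> borel_measurable M" and "0 \<le> c"
    and step: "\<And>n. mean_square M (\<lambda>\<omega>. X n \<omega> - X (Suc n) \<omega>) \<le> ennreal ((c * (1/2) ^ n)\<^sup>2)"
  shows "mean_square M (\<lambda>\<omega>. X n \<omega> - X (n + k) \<omega>) \<le> ennreal ((2 * c * (1/2) ^ n)\<^sup>2)"
proof -
  have "mean_square M (\<lambda>\<omega>. X n \<omega> - X (n + k) \<omega>) \<le> ennreal ((2 * c * ((1/2) ^ n - (1/2) ^ (n + k)))\<^sup>2)"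
  proof (induction k)
    case 0
    then show ?case by (simp add: mean_square_def)
  next
    case (Suc k)
    have "mean_square M (\<lambda>\<omega>. (X n \<omega> - X (n + k) \<omega>) + (X (n + k) \<omega> - X (n + Suc k) \<omega>)) \<le>
        ennreal ((2 * c * ((1/2) ^ n - (1/2) ^ (n + k)) + c * (1/2) ^ (n + k))\<^sup>2)"
      using Suc step[of "n + k"] \<open>0 \<le> c\<close>
      by (intro mean_square_add_le) (auto intro!: mult_nonneg_nonneg power_decreasing)
    then show ?case by (simp add: algebra_simps)
  qed
  also have "\<dots> \<le> ennreal ((2 * c * (1/2) ^ n)\<^sup>2)"
    using \<open>0 \<le> c\<close> by (intro ennreal_leI power_mono mult_left_mono mult_nonneg_nonneg)
      (auto intro: power_decreasing)
  finally show ?thesis .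
qed

lemma (in prob_space) AE_convergent_if_mean_square_geometric:
  fixes X :: "nat \<Rightarrow> 'a \<Rightarrow> 'b::{banach, second_countable_topology}"
  assumes [measurable]: "\<And>n. X n \<in> borel_measurable M" and "0 \<le> c"
    and step: "\<And>n. mean_square M (\<lambda>\<omega>. X n \<omega> - X (Suc n) \<omega>) \<le> ennreal ((c * (1/2) ^ n)\<^sup>2)"
  shows "AE \<omega> in M. convergent (\<lambda>n. X n \<omega>)"
proof -
  have "(\<integral>\<^sup>+ \<omega>. (\<Sum>n. ennreal (norm (X n \<omega> - X (Suc n) \<omega>))) \<partial>M) =
      (\<Sum>n. \<integral>\<^sup>+ \<omega>. ennreal (norm (X n \<omega> - X (Suc n) \<omega>)) \<partial>M)"
    by (intro nn_integral_suminf) measurable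
  also have "\<dots> \<le> (\<Sum>n. ennreal (c * (1/2) ^ n))"
  proof (intro suminf_le summableI)
    fix n
    have "mean_square M (\<lambda>_. 1 :: real) \<le> ennreal (1\<^sup>2)" by (intro mean_square_le_const) simp
    with step[of n] \<open>0 \<le> c\<close>
    have "(\<integral>\<^sup>+ \<omega>. ennreal (norm (X n \<omega> - X (Suc n) \<omega>) * norm (1 :: real)) \<partial>M) \<le>
        ennreal (c * (1/2) ^ n * 1)"
      by (intro nn_integral_mult_le_mean_square) auto
    then show "(\<integral>\<^sup>+ \<omega>. ennreal (norm (X n \<omega> - X (Suc n) \<omega>)) \<partial>M) \<le> ennreal (c * (1/2) ^ n)" by simp
  qed
  also have "\<dots> < \<infinity>"
  proof -
    have "summable (\<lambda>n. c * (1/2) ^ n)" by (intro summable_mult summable_geometric) simp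
    then show ?thesis using \<open>0 \<le> c\<close> by (simp add: suminf_ennreal2)
  qed
  finally have "AE \<omega> in M. (\<Sum>n. ennreal (norm (X n \<omega> - X (Suc n) \<omega>))) \<noteq> \<infinity>"
    by (intro nn_integral_noteq_infinite) auto
  then show ?thesis
  proof eventually_elim
    case (elim \<omega>)
    then have "summable (\<lambda>n. X n \<omega> - X (Suc n) \<omega>)"
      by (intro summable_norm_cancel[OF summable_suminf_not_top]) auto
    then have "convergent (\<lambda>n. X 0 \<omega> - (\<Sum>i<n. X i \<omega> - X (Suc i) \<omega>))"
      by (intro convergent_diff convergent_const) (simp add: summable_iff_convergent)
    then show ?case by (simp add: sum_lessThan_telescope'[of "\<lambda>i. X i \<omega>"])
  qed
qed

lemma (in prob_space) mean_square_limit_exists: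
  fixes X :: "nat \<Rightarrow> 'a \<Rightarrow> 'b::{banach, second_countable_topology}"
  assumes X[measurable]: "\<And>n. X n \<in> borel_measurable M" and c: "0 \<le> c"
    and step: "\<And>n. mean_square M (\<lambda>\<omega>. X n \<omega> - X (Suc n) \<omega>) \<le> ennreal ((c * (1/2) ^ n)\<^sup>2)"
  obtains Y where "Y \<in> borel_measurable M"
    "\<And>n. mean_square M (\<lambda>\<omega>. X n \<omega> - Y \<omega>) \<le> ennreal ((2 * c * (1/2) ^ n)\<^sup>2)"
proof
  define Y where "Y \<omega> = lim (\<lambda>n. X n \<omega>)" for \<omega>
  show [measurable]: "Y \<in> borel_measurable M" unfolding Y_def by measurable
  fix n
  have "mean_square M (\<lambda>\<omega>. X n \<omega> - Y \<omega>) =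
      (\<integral>\<^sup>+ \<omega>. liminf (\<lambda>k. ennreal ((norm (X n \<omega> - X (n + k) \<omega>))\<^sup>2)) \<partial>M)"
    unfolding mean_square_def
  proof (rule nn_integral_cong_AE)
    show "AE \<omega> in M. ennreal ((norm (X n \<omega> - Y \<omega>))\<^sup>2) =
        liminf (\<lambda>k. ennreal ((norm (X n \<omega> - X (n + k) \<omega>))\<^sup>2))"
      using AE_convergent_if_mean_square_geometric[OF X c step]
    proof eventually_elim
      case (elim \<omega>)
      then have "(\<lambda>k. X k \<omega>) \<longlonglongrightarrow> Y \<omega>" by (simp add: Y_def convergent_LIMSEQ_iff)
      from LIMSEQ_ignore_initial_segment[OF this, of n] have "(\<lambda>k. X (n + k) \<omega>) \<longlonglongrightarrow> Y \<omega>"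
        by (simp add: add.commute)
      then have "(\<lambda>k. ennreal ((norm (X n \<omega> - X (n + k) \<omega>))\<^sup>2)) \<longlonglongrightarrow> ennreal ((norm (X n \<omega> - Y \<omega>))\<^sup>2)"
        by (intro tendsto_intros tendsto_ennrealI)
      from lim_imp_Liminf[OF _ this] show ?case by simp
    qed
  qed
  also have "\<dots> \<le> liminf (\<lambda>k. mean_square M (\<lambda>\<omega>. X n \<omega> - X (n + k) \<omega>))"
    unfolding mean_square_def by (rule nn_integral_liminf) measurable
  also have "\<dots> \<le> ennreal ((2 * c * (1/2) ^ n)\<^sup>2)"
    using mean_square_telescope_le[OF X c step] by (intro Liminf_le always_eventually) auto
  finally show "mean_square M (\<lambda>\<omega>. X n \<omega> - Y \<omega>) \<le> ennreal ((2 * c * (1/2) ^ n)\<^sup>2)" .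
qed

section \<open>Limits in metric spaces\<close>

lemma (in Metric_space) limitin_if_dist_square_le:
  assumes mcomplete and M: "\<And>n. N \<le> n \<Longrightarrow> \<sigma> n \<in> M" and r: "r \<longlonglongrightarrow> 0"
    and dist: "\<And>m n. N \<le> m \<Longrightarrow> N \<le> n \<Longrightarrow> (d (\<sigma> m) (\<sigma> n))\<^sup>2 \<le> r m + r n"
  obtains x where "limitin mtopology \<sigma> x sequentially"
proof -
  have "\<exists>n\<^sub>0. \<forall>m n. n\<^sub>0 \<le> m \<longrightarrow> n\<^sub>0 \<le> n \<longrightarrow> d (\<sigma> m) (\<sigma> n) < \<epsilon>" if "\<epsilon> > 0" for \<epsilon>
  proof -
    have "\<forall>\<^sub>F n in sequentially. r n < \<epsilon>\<^sup>2 / 2" using r that by (intro order_tendstoD(2)) auto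
    then obtain n\<^sub>0 where n\<^sub>0: "\<And>n. n\<^sub>0 \<le> n \<Longrightarrow> r n < \<epsilon>\<^sup>2 / 2" by (auto simp: eventually_sequentially)
    have "d (\<sigma> m) (\<sigma> n) < \<epsilon>" if mn: "max N n\<^sub>0 \<le> m" "max N n\<^sub>0 \<le> n" for m n
    proof (rule power2_less_imp_less)
      show "(d (\<sigma> m) (\<sigma> n))\<^sup>2 < \<epsilon>\<^sup>2" using dist[of m n] n\<^sub>0[of m] n\<^sub>0[of n] mn by simp
    qed (use \<open>\<epsilon> > 0\<close> in simp)
    then show ?thesis by blast
  qed
  moreover have "\<forall>\<^sub>F n in sequentially. \<sigma> n \<in> M" using M by (auto simp: eventually_sequentially)
  ultimately show ?thesis using \<open>mcomplete\<close> that unfolding mcomplete by blast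
qed

lemma (in Metric_space) tendsto_dist_if_limitin:
  assumes lim: "limitin mtopology \<sigma> y F" and "x \<in> M"
  shows "((\<lambda>n. d x (\<sigma> n)) \<longlongrightarrow> d x y) F"
proof -
  have "((\<lambda>n. d x (\<sigma> n) - d x y) \<longlongrightarrow> 0) F"
  proof (rule Lim_null_comparison)
    have y: "y \<in> M" using lim by (simp add: limitin_metric_dist_null)
    have "\<forall>\<^sub>F n in F. \<sigma> n \<in> M" using lim by (simp add: limitin_metric_dist_null)
    then show "\<forall>\<^sub>F n in F. norm (d x (\<sigma> n) - d x y) \<le> d (\<sigma> n) y"
    proof eventually_elim
      case (elim n)
      then show ?case
        using mdist_reverse_triangle[OF elim \<open>x \<in> M\<close> y] by (simp add: commute)
    qed
    show "((\<lambda>n. d (\<sigma> n) y) \<longlongrightarrow> 0) F" using lim by (simp add: limitin_metric_dist_null)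
  qed
  then show ?thesis by (simp add: LIM_zero_iff)
qed

lemma (in Metric_space) mcomplete_if_geometric_convergent:
  assumes "\<And>\<sigma>. range \<sigma> \<subseteq> M \<Longrightarrow> (\<And>n. d (\<sigma> n) (\<sigma> (Suc n)) < (1/2) ^ n) \<Longrightarrow>
      \<exists>x. limitin mtopology \<sigma> x sequentially"
  shows mcomplete
  unfolding mcomplete_def
proof (intro allI impI)
  fix \<sigma> assume \<sigma>: "MCauchy \<sigma>"
  then have "\<exists>N. \<forall>m\<ge>N. \<forall>n\<ge>N. d (\<sigma> m) (\<sigma> n) < (1/2) ^ k" for k :: nat
    unfolding MCauchy_def by (metis half_gt_zero zero_less_one zero_less_power)
  then obtain N where N: "\<And>k m n. N k \<le> m \<Longrightarrow> N k \<le> n \<Longrightarrow> d (\<sigma> m) (\<sigma> n) < (1/2) ^ k" by metis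
  define r where "r k = (\<Sum>i\<le>k. Suc (N i))" for k
  have r: "strict_mono r" "N k \<le> r k" for k
  proof -
    show "strict_mono r" by (simp add: strict_mono_Suc_iff r_def)
    show "N k \<le> r k" unfolding r_def by (cases k) auto
  qed
  have "range (\<sigma> \<circ> r) \<subseteq> M" using \<sigma> by (auto simp: MCauchy_def)
  moreover have "d ((\<sigma> \<circ> r) k) ((\<sigma> \<circ> r) (Suc k)) < (1/2) ^ k" for k
  proof -
    have "r k \<le> r (Suc k)" using r(1) by (simp add: strict_mono_less_eq)
    then show ?thesis using r(2)[of k] by (simp add: N)
  qed
  ultimately obtain x where "limitin mtopology (\<sigma> \<circ> r) x sequentially" using assms by blast
  then show "\<exists>x. limitin mtopology \<sigma> x sequentially"
    using MCauchy_convergent_subsequence[OF \<sigma> r(1)] by blast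
qed

section \<open>The Wasserstein space\<close>

definition W2d :: "'a::euclidean_space measure \<Rightarrow> 'a measure \<Rightarrow> real" where
  "W2d \<mu> \<nu> = sqrt (enn2real (W2sq \<mu> \<nu>))"

lemma W2d_nonneg: "0 \<le> W2d \<mu> \<nu>"
  by (simp add: W2d_def)

lemma W2sq_eq_W2d: "W2sq \<mu> \<nu> < \<infinity> \<Longrightarrow> W2sq \<mu> \<nu> = ennreal ((W2d \<mu> \<nu>)\<^sup>2)"
  by (simp add: W2d_def)

lemma W2_eq_W2d: "W2sq \<mu> \<nu> < \<infinity> \<Longrightarrow> W2 \<mu> \<nu> = ennreal (W2d \<mu> \<nu>)"
  by (simp add: W2_def W2d_def)

lemma W2d_le:
  assumes "W2sq \<mu> \<nu> \<le> ennreal (c\<^sup>2)" "0 \<le> c"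
  shows "W2d \<mu> \<nu> \<le> c"
  using enn2real_mono[OF assms(1)] assms(2) by (simp add: W2d_def real_le_lsqrt)

lemma P2_iff: "\<mu> \<in> P2 \<omega>0 \<longleftrightarrow> \<mu> \<in> Pm \<and> W2sq \<mu> \<omega>0 < \<infinity>"
  by (auto simp: P2_def W2_def top.not_eq_extremum)

lemma couplingsD:
  assumes "\<gamma> \<in> couplings \<mu> \<nu>"
  shows "prob_space \<gamma>" "sets \<gamma> = sets borel" "distr \<gamma> borel fst = \<mu>" "distr \<gamma> borel snd = \<nu>"
    "fst \<in> borel_measurable \<gamma>" "snd \<in> borel_measurable \<gamma>"
proof -
  show laws: "prob_space \<gamma>" "sets \<gamma> = sets borel" "distr \<gamma> borel fst = \<mu>" "distr \<gamma> borel snd = \<nu>"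
    using assms by (auto simp: couplings_def)
  show "fst \<in> borel_measurable \<gamma>" "snd \<in> borel_measurable \<gamma>"
    using fst_borel_measurable snd_borel_measurable measurable_cong_sets[OF laws(2) refl] by blast+
qed

lemma cost2_eq_mean_square: "cost2 \<gamma> = mean_square \<gamma> (\<lambda>p. fst p - snd p)"
  by (simp add: cost2_def mean_square_def)

lemma distr_Pair_in_couplings:
  assumes "prob_space M" and [measurable]: "f \<in> borel_measurable M" "g \<in> borel_measurable M"
  shows "distr M borel (\<lambda>\<omega>. (f \<omega>, g \<omega>)) \<in> couplings (distr M borel f) (distr M borel g)"
proof -
  have pair: "(\<lambda>\<omega>. (f \<omega>, g \<omega>)) \<in> borel_measurable M" by (intro borel_measurable_Pair) measurable
  show ?thesis
    using prob_space.prob_space_distr[OF assms(1) pair]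
    by (simp add: couplings_def distr_distr[OF fst_borel_measurable pair]
        distr_distr[OF snd_borel_measurable pair] comp_def)
qed

lemma cost2_distr_Pair:
  fixes f g :: "'b \<Rightarrow> 'a::euclidean_space"
  assumes [measurable]: "f \<in> borel_measurable M" "g \<in> borel_measurable M"
  shows "cost2 (distr M borel (\<lambda>\<omega>. (f \<omega>, g \<omega>))) = mean_square M (\<lambda>\<omega>. f \<omega> - g \<omega>)"
proof -
  note [measurable] = fst_borel_measurable snd_borel_measurable
  show ?thesis unfolding cost2_eq_mean_square by (subst mean_square_distr) simp_all
qed

lemma W2sq_distr_le:
  fixes f g :: "'b \<Rightarrow> 'a::euclidean_space"
  assumes "prob_space M" "f \<in> borel_measurable M" "g \<in> borel_measurable M"
  shows "W2sq (distr M borel f) (distr M borel g) \<le> mean_square M (\<lambda>\<omega>. f \<omega> - g \<omega>)"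
  unfolding W2sq_def cost2_distr_Pair[OF assms(2,3), symmetric]
  by (rule INF_lower[OF distr_Pair_in_couplings[OF assms]])

lemma W2sq_commute: "W2sq \<mu> \<nu> = W2sq \<nu> (\<mu> :: 'a::euclidean_space measure)"
proof -
  have "W2sq \<mu> \<nu> \<le> W2sq \<nu> \<mu>" for \<mu> \<nu> :: "'a measure"
    unfolding W2sq_def[of \<nu>]
  proof (rule INF_greatest)
    fix \<gamma> assume "\<gamma> \<in> couplings \<nu> \<mu>"
    note \<gamma> = couplingsD[OF this]
    show "W2sq \<mu> \<nu> \<le> cost2 \<gamma>"
      using W2sq_distr_le[OF \<gamma>(1,6,5)]
      by (simp add: \<gamma> cost2_eq_mean_square mean_square_minus_commute[of \<gamma> fst])
  qed
  then show ?thesis by (intro antisym)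
qed

lemma W2sq_self: "\<mu> \<in> Pm \<Longrightarrow> W2sq \<mu> \<mu> = 0"
  using W2sq_distr_le[of \<mu> "\<lambda>x. x" "\<lambda>x. x"]
  by (simp add: Pm_def distr_id2 mean_square_def measurable_ident_sets)

lemma W2sq_finite_imp_Pm:
  assumes "W2sq \<mu> \<nu> < \<infinity>"
  shows "\<mu> \<in> Pm" "\<nu> \<in> Pm"
proof -
  have "couplings \<mu> \<nu> \<noteq> {}" using assms by (force simp: W2sq_def)
  then obtain \<gamma> where "\<gamma> \<in> couplings \<mu> \<nu>" by blast
  note \<gamma> = couplingsD[OF this]
  show "\<mu> \<in> Pm" unfolding \<gamma>(3)[symmetric] Pm_def by (simp add: prob_space.prob_space_distr[OF \<gamma>(1,5)])
  show "\<nu> \<in> Pm" unfolding \<gamma>(4)[symmetric] Pm_def by (simp add: prob_space.prob_space_distr[OF \<gamma>(1,6)])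
qed

lemma near_optimal_coupling:
  assumes fin: "W2sq \<mu> \<nu> < \<infinity>" and less: "W2d \<mu> \<nu> < c"
  obtains \<gamma> b where "\<gamma> \<in> couplings \<mu> \<nu>" "cost2 \<gamma> \<le> ennreal (b\<^sup>2)" "0 \<le> b" "b < c"
proof -
  obtain b where b: "W2d \<mu> \<nu> < b" "b < c" using less dense by blast
  have b_pos: "0 < b" using b(1) W2d_nonneg[of \<mu> \<nu>] by linarith
  have "(W2d \<mu> \<nu>)\<^sup>2 < b\<^sup>2" using b(1) W2d_nonneg by (intro power_strict_mono) auto
  then have "W2sq \<mu> \<nu> < ennreal (b\<^sup>2)"
    using fin b_pos by (subst W2sq_eq_W2d) (auto intro!: ennreal_lessI)
  then obtain \<gamma> where "\<gamma> \<in> couplings \<mu> \<nu>" "cost2 \<gamma> < ennreal (b\<^sup>2)"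
    by (auto simp: W2sq_def INF_less_iff)
  then show ?thesis using b(2) b_pos by (intro that[of \<gamma> b]) auto
qed

lemma mean_square_distr_coupling_le:
  fixes Z Z' :: "'b \<Rightarrow> 'a::euclidean_space \<times> 'a"
  assumes "prob_space M" and Z[measurable]: "Z \<in> borel_measurable M" "Z' \<in> borel_measurable M"
    and cost: "cost2 (distr M borel Z) \<le> ennreal (b\<^sup>2)" and "0 \<le> b" "b \<le> c"
    and near: "AE \<omega> in M. dist (snd (Z \<omega>)) (fst (Z' \<omega>)) < c - b"
  shows "mean_square M (\<lambda>\<omega>. fst (Z \<omega>) - fst (Z' \<omega>)) \<le> ennreal (c\<^sup>2)"
proof -
  interpret prob_space M by fact
  note [measurable] = fst_borel_measurable snd_borel_measurable
  have "cost2 (distr M borel Z) = mean_square M (\<lambda>\<omega>. fst (Z \<omega>) - snd (Z \<omega>))"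
    unfolding cost2_eq_mean_square by (subst mean_square_distr) simp_all
  moreover have "mean_square M (\<lambda>\<omega>. snd (Z \<omega>) - fst (Z' \<omega>)) \<le> ennreal ((c - b)\<^sup>2)"
    using near by (intro mean_square_le_const) (auto simp: dist_norm elim: eventually_mono)
  ultimately have "mean_square M (\<lambda>\<omega>. (fst (Z \<omega>) - snd (Z \<omega>)) + (snd (Z \<omega>) - fst (Z' \<omega>))) \<le>
      ennreal ((b + (c - b))\<^sup>2)"
    using assms by (intro mean_square_add_le) auto
  then show ?thesis by simp
qed

text \<open>The slack in the strict inequality absorbs the gluing error.\<close>

lemma Wasserstein_chain_realization:
  fixes \<mu> :: "nat \<Rightarrow> 'a::euclidean_space measure"
  assumes fin: "\<And>n. W2sq (\<mu> n) (\<mu> (Suc n)) < \<infinity>" and less: "\<And>n. W2d (\<mu> n) (\<mu> (Suc n)) < c n"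
  obtains \<Omega> :: "(nat \<Rightarrow> 'a \<times> 'a) measure" and X where
    "prob_space \<Omega>" "\<And>n. X n \<in> borel_measurable \<Omega>" "\<And>n. distr \<Omega> borel (X n) = \<mu> n"
    "\<And>n. mean_square \<Omega> (\<lambda>\<omega>. X n \<omega> - X (Suc n) \<omega>) \<le> ennreal ((c n)\<^sup>2)"
proof -
  define near_optimal where "near_optimal n b \<gamma> \<longleftrightarrow>
    \<gamma> \<in> couplings (\<mu> n) (\<mu> (Suc n)) \<and> cost2 \<gamma> \<le> ennreal (b\<^sup>2) \<and> 0 \<le> b \<and> b < c n" for n b \<gamma>
  have "\<exists>b \<gamma>. near_optimal n b \<gamma>" for n
    unfolding near_optimal_def by (rule near_optimal_coupling[OF fin less, of n]) blast
  then obtain b \<gamma> where "\<And>n. near_optimal n (b n) (\<gamma> n)" by metis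
  then have \<gamma>: "\<And>n. \<gamma> n \<in> couplings (\<mu> n) (\<mu> (Suc n))"
    and cost: "\<And>n. cost2 (\<gamma> n) \<le> ennreal ((b n)\<^sup>2)" and b: "\<And>n. 0 \<le> b n" "\<And>n. b n < c n"
    by (simp_all add: near_optimal_def)
  note \<gamma>D = couplingsD[OF \<gamma>]
  have match: "distr (\<gamma> n) borel snd = distr (\<gamma> (Suc n)) borel fst" for n by (simp add: \<gamma>D)
  have slack: "0 < c n - b n" for n using b by simp
  obtain \<Omega> :: "(nat \<Rightarrow> 'a \<times> 'a) measure" and Z where \<Omega>: "prob_space \<Omega>"
    and Z: "\<And>n. Z n \<in> borel_measurable \<Omega>" "\<And>n. distr \<Omega> borel (Z n) = \<gamma> n"
    and near: "\<And>n. AE \<omega> in \<Omega>. dist (snd (Z n \<omega>)) (fst (Z (Suc n) \<omega>)) < c n - b n"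
    by (rule approximate_gluing[of \<gamma> "\<lambda>n. c n - b n", OF \<gamma>D(1,2) match slack]) (rule that)
  show ?thesis
  proof
    show "prob_space \<Omega>" by fact
    show "(\<lambda>\<omega>. fst (Z n \<omega>)) \<in> borel_measurable \<Omega>" for n
      by (rule measurable_compose[OF Z(1) fst_borel_measurable])
    show "distr \<Omega> borel (\<lambda>\<omega>. fst (Z n \<omega>)) = \<mu> n" for n
      using distr_distr[OF fst_borel_measurable Z(1)] by (simp add: comp_def Z(2) \<gamma>D)
    show "mean_square \<Omega> (\<lambda>\<omega>. fst (Z n \<omega>) - fst (Z (Suc n) \<omega>)) \<le> ennreal ((c n)\<^sup>2)" for n
      using cost[of n] b near by (intro mean_square_distr_coupling_le[OF \<Omega> Z(1) Z(1)])
        (auto simp: Z(2) less_imp_le)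
  qed
qed

lemma W2sq_le_add:
  fixes \<mu> \<nu> \<rho> :: "'a::euclidean_space measure"
  assumes fin: "W2sq \<mu> \<nu> < \<infinity>" "W2sq \<nu> \<rho> < \<infinity>"
    and less: "W2d \<mu> \<nu> < a" "W2d \<nu> \<rho> < b"
  shows "W2sq \<mu> \<rho> \<le> ennreal ((a + b)\<^sup>2)"
proof -
  define \<sigma> where "\<sigma> n = (if n = 0 then \<mu> else if n = 1 then \<nu> else \<rho>)" for n :: nat
  define c where "c n = (if n = 0 then a else if n = 1 then b else 1)" for n :: nat
  have chain: "W2sq (\<sigma> n) (\<sigma> (Suc n)) < \<infinity>" "W2d (\<sigma> n) (\<sigma> (Suc n)) < c n" for n
    using fin less W2sq_self[OF W2sq_finite_imp_Pm(2)[OF fin(2)]] by (auto simp: \<sigma>_def c_def W2d_def)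
  obtain \<Omega> :: "(nat \<Rightarrow> 'a \<times> 'a) measure" and X where \<Omega>: "prob_space \<Omega>"
    and X: "\<And>n. X n \<in> borel_measurable \<Omega>" "\<And>n. distr \<Omega> borel (X n) = \<sigma> n"
    and step: "\<And>n. mean_square \<Omega> (\<lambda>\<omega>. X n \<omega> - X (Suc n) \<omega>) \<le> ennreal ((c n)\<^sup>2)"
    by (rule Wasserstein_chain_realization[of \<sigma> c, OF chain]) (rule that)
  have "W2sq \<mu> \<rho> \<le> mean_square \<Omega> (\<lambda>\<omega>. (X 0 \<omega> - X 1 \<omega>) + (X 1 \<omega> - X 2 \<omega>))"
    using W2sq_distr_le[OF \<Omega> X(1)[of 0] X(1)[of 2]] by (simp add: X(2) \<sigma>_def)
  also have "\<dots> \<le> ennreal ((a + b)\<^sup>2)"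
    using step[of 0] step[of 1] less W2d_nonneg[of \<mu> \<nu>] W2d_nonneg[of \<nu> \<rho>] X(1)
    by (intro mean_square_add_le) (auto simp: c_def numeral_2_eq_2)
  finally show ?thesis .
qed

lemma W2sq_finite_trans:
  assumes "W2sq \<mu> \<nu> < \<infinity>" "W2sq \<nu> \<rho> < \<infinity>"
  shows "W2sq \<mu> \<rho> < \<infinity>"
  using W2sq_le_add[OF assms, of "W2d \<mu> \<nu> + 1" "W2d \<nu> \<rho> + 1"] by (simp add: order_le_less_trans)

lemma W2d_triangle:
  assumes "W2sq \<mu> \<nu> < \<infinity>" "W2sq \<nu> \<rho> < \<infinity>"
  shows "W2d \<mu> \<rho> \<le> W2d \<mu> \<nu> + W2d \<nu> \<rho>"
proof (rule field_le_epsilon)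
  fix \<epsilon> :: real assume "\<epsilon> > 0"
  then have "W2d \<mu> \<rho> \<le> (W2d \<mu> \<nu> + \<epsilon> / 2) + (W2d \<nu> \<rho> + \<epsilon> / 2)"
    using W2d_nonneg[of \<mu> \<nu>] W2d_nonneg[of \<nu> \<rho>] by (intro W2d_le W2sq_le_add[OF assms]) auto
  then show "W2d \<mu> \<rho> \<le> W2d \<mu> \<nu> + W2d \<nu> \<rho> + \<epsilon>" by simp
qed

lemma emeasure_closed_le_infdist_if_W2sq_eq_0:
  fixes \<mu> \<nu> :: "'a::euclidean_space measure"
  assumes "W2sq \<mu> \<nu> = 0" and "closed C" and "0 < r"
  shows "emeasure \<mu> C \<le> emeasure \<nu> {y. infdist y C \<le> r}"
proof (rule ennreal_le_epsilon)
  fix e :: real assume "0 < e"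
  then have "W2d \<mu> \<nu> < r * sqrt e" using assms by (simp add: W2d_def)
  then obtain \<gamma> b where "\<gamma> \<in> couplings \<mu> \<nu>" and cost: "cost2 \<gamma> \<le> ennreal (b\<^sup>2)"
    and b: "0 \<le> b" "b < r * sqrt e"
    using near_optimal_coupling[of \<mu> \<nu> "r * sqrt e"] assms(1) by auto
  note \<gamma> = couplingsD[OF this(1)]
  have "emeasure \<mu> C \<le> emeasure \<nu> {y. infdist y C \<le> r} + ennreal (1 / r\<^sup>2) * cost2 \<gamma>"
    using emeasure_distr_closed_le_mean_square[OF \<gamma>(5,6) assms(2,3)]
    by (simp add: \<gamma>(3,4) cost2_eq_mean_square)
  also have "\<dots> \<le> emeasure \<nu> {y. infdist y C \<le> r} + ennreal (1 / r\<^sup>2) * ennreal ((r * sqrt e)\<^sup>2)"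
    using b by (intro add_left_mono mult_left_mono order_trans[OF cost] ennreal_leI power_mono) auto
  also have "ennreal (1 / r\<^sup>2) * ennreal ((r * sqrt e)\<^sup>2) = ennreal e"
    using \<open>0 < r\<close> \<open>0 < e\<close> by (simp add: ennreal_mult[symmetric] power_mult_distrib)
  finally show "emeasure \<mu> C \<le> emeasure \<nu> {y. infdist y C \<le> r} + ennreal e" .
qed

lemma emeasure_closed_le_if_W2sq_eq_0:
  fixes \<mu> \<nu> :: "'a::euclidean_space measure"
  assumes "W2sq \<mu> \<nu> = 0" and C: "closed C" "C \<noteq> {}"
  shows "emeasure \<mu> C \<le> emeasure \<nu> C"
proof -
  have "\<nu> \<in> Pm" using W2sq_finite_imp_Pm(2)[of \<mu> \<nu>] assms(1) by simp
  then interpret prob_space \<nu> by (simp add: Pm_def)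
  define B where "B n = {y. infdist y C \<le> 1 / real (Suc n)}" for n
  have "(\<lambda>n. emeasure \<nu> (B n)) \<longlonglongrightarrow> emeasure \<nu> (\<Inter>n. B n)"
  proof (rule Lim_emeasure_decseq)
    have "closed (B n)" for n unfolding B_def by (intro closed_Collect_le continuous_intros)
    then show "range B \<subseteq> events" using \<open>\<nu> \<in> Pm\<close> by (auto simp: Pm_def)
    show "decseq B"
    proof (rule decseq_SucI)
      fix n
      have "1 / real (Suc (Suc n)) \<le> 1 / real (Suc n)" by (intro divide_left_mono) auto
      then show "B (Suc n) \<subseteq> B n" by (auto simp: B_def)
    qed
  qed simp
  moreover have "(\<Inter>n. B n) = C"
  proof -
    have "infdist y C \<le> 0" if "\<And>n. infdist y C \<le> 1 / real (Suc n)" for y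
      using that by (intro LIMSEQ_le_const[OF LIMSEQ_Suc[OF lim_1_over_n]]) auto
    then have "(\<Inter>n. B n) = {y. infdist y C = 0}"
      by (auto simp: B_def intro: antisym infdist_nonneg)
    also have "\<dots> = C" using in_closed_iff_infdist_zero[OF C] by auto
    finally show ?thesis .
  qed
  moreover have "emeasure \<mu> C \<le> emeasure \<nu> (B n)" for n
    unfolding B_def by (rule emeasure_closed_le_infdist_if_W2sq_eq_0[OF assms(1,2)]) simp
  ultimately show ?thesis by (intro LIMSEQ_le_const) auto
qed

lemma W2sq_eq_0_imp_eq:
  fixes \<mu> \<nu> :: "'a::euclidean_space measure"
  assumes "W2sq \<mu> \<nu> = 0"
  shows "\<mu> = \<nu>"
proof (rule measure_eqI_generator_eq)
  have Pm: "\<mu> \<in> Pm" "\<nu> \<in> Pm" using W2sq_finite_imp_Pm[of \<mu> \<nu>] assms by simp_all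
  then show "sets \<mu> = sigma_sets UNIV (Collect closed)" "sets \<nu> = sigma_sets UNIV (Collect closed)"
    by (simp_all add: Pm_def borel_eq_closed)
  show "emeasure \<mu> C = emeasure \<nu> C" if "C \<in> Collect closed" for C
  proof (cases "C = {}")
    case False
    then show ?thesis
      using emeasure_closed_le_if_W2sq_eq_0[of \<mu> \<nu> C] emeasure_closed_le_if_W2sq_eq_0[of \<nu> \<mu> C]
        that assms by (simp add: W2sq_commute[of \<nu>])
  qed simp
  have "prob_space \<mu>" using Pm by (simp add: Pm_def)
  then show "emeasure \<mu> ((\<lambda>_::nat. UNIV) i) \<noteq> \<infinity>" for i
    by (simp add: finite_measure.emeasure_finite prob_space.finite_measure)
qed (auto simp: Int_stable_def)

lemma W2sq_finite:
  assumes "\<mu> \<in> P2 \<omega>0" "\<nu> \<in> P2 \<omega>0"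
  shows "W2sq \<mu> \<nu> < \<infinity>"
  using W2sq_finite_trans[of \<mu> \<omega>0 \<nu>] assms by (simp add: P2_iff W2sq_commute[of \<omega>0])

lemma Metric_space_P2: "Metric_space (P2 \<omega>0) (W2d :: 'a::euclidean_space measure \<Rightarrow> 'a measure \<Rightarrow> real)"
proof
  fix \<mu> \<nu> \<rho> :: "'a measure"
  show "0 \<le> W2d \<mu> \<nu>" by (rule W2d_nonneg)
  show "W2d \<mu> \<nu> = W2d \<nu> \<mu>" by (simp add: W2d_def W2sq_commute)
  assume \<mu>\<nu>: "\<mu> \<in> P2 \<omega>0" "\<nu> \<in> P2 \<omega>0"
  then show "W2d \<mu> \<nu> = 0 \<longleftrightarrow> \<mu> = \<nu>"
    using W2sq_eq_W2d[OF W2sq_finite[OF \<mu>\<nu>]] W2sq_eq_0_imp_eq by (auto simp: W2d_def W2sq_self P2_iff)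
  assume "\<rho> \<in> P2 \<omega>0"
  then show "W2d \<mu> \<rho> \<le> W2d \<mu> \<nu> + W2d \<nu> \<rho>"
    using \<mu>\<nu> by (intro W2d_triangle W2sq_finite)
qed

lemma W2sq_geometric_limit_exists:
  fixes \<sigma> :: "nat \<Rightarrow> 'a::euclidean_space measure"
  assumes "\<And>n. W2sq (\<sigma> n) (\<sigma> (Suc n)) < \<infinity>" "\<And>n. W2d (\<sigma> n) (\<sigma> (Suc n)) < (1/2) ^ n"
  obtains \<mu> where "\<And>n. W2sq (\<sigma> n) \<mu> \<le> ennreal ((2 * (1/2) ^ n)\<^sup>2)"
proof -
  obtain \<Omega> :: "(nat \<Rightarrow> 'a \<times> 'a) measure" and X where \<Omega>: "prob_space \<Omega>"
    and X: "\<And>n. X n \<in> borel_measurable \<Omega>" "\<And>n. distr \<Omega> borel (X n) = \<sigma> n"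
    and "\<And>n. mean_square \<Omega> (\<lambda>\<omega>. X n \<omega> - X (Suc n) \<omega>) \<le> ennreal (((1/2) ^ n)\<^sup>2)"
    by (rule Wasserstein_chain_realization[of \<sigma> "\<lambda>n. (1/2) ^ n", OF assms]) (rule that)
  then have step: "mean_square \<Omega> (\<lambda>\<omega>. X n \<omega> - X (Suc n) \<omega>) \<le> ennreal ((1 * (1/2) ^ n)\<^sup>2)" for n
    by simp
  interpret prob_space \<Omega> by fact
  obtain Y where Y: "Y \<in> borel_measurable \<Omega>"
    and limit: "\<And>n. mean_square \<Omega> (\<lambda>\<omega>. X n \<omega> - Y \<omega>) \<le> ennreal ((2 * 1 * (1/2) ^ n)\<^sup>2)"
    by (rule mean_square_limit_exists[OF X(1) _ step]) (auto intro: that)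
  have "W2sq (\<sigma> n) (distr \<Omega> borel Y) \<le> ennreal ((2 * (1/2) ^ n)\<^sup>2)" for n
    using order_trans[OF W2sq_distr_le[OF \<Omega> X(1) Y] limit[of n]] by (simp add: X(2))
  then show ?thesis by (rule that)
qed

lemma mcomplete_P2:
  "Metric_space.mcomplete (P2 \<omega>0) (W2d :: 'a::euclidean_space measure \<Rightarrow> 'a measure \<Rightarrow> real)"
proof -
  interpret Metric_space "P2 \<omega>0" W2d by (rule Metric_space_P2)
  show ?thesis
  proof (rule mcomplete_if_geometric_convergent)
    fix \<sigma> :: "nat \<Rightarrow> 'a measure"
    assume "range \<sigma> \<subseteq> P2 \<omega>0" and fast: "\<And>n. W2d (\<sigma> n) (\<sigma> (Suc n)) < (1/2) ^ n"
    then have \<sigma>: "\<sigma> n \<in> P2 \<omega>0" for n by auto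
    obtain \<mu> where \<mu>: "\<And>n. W2sq (\<sigma> n) \<mu> \<le> ennreal ((2 * (1/2) ^ n)\<^sup>2)"
      by (rule W2sq_geometric_limit_exists[OF W2sq_finite[OF \<sigma> \<sigma>] fast]) (rule that)
    have "W2sq \<mu> (\<sigma> 0) < \<infinity>"
      using \<mu>[of 0] by (simp add: W2sq_commute[of \<mu>] order_le_less_trans)
    moreover have "W2sq (\<sigma> 0) \<omega>0 < \<infinity>" using \<sigma>[of 0] by (simp add: P2_iff)
    ultimately have "\<mu> \<in> P2 \<omega>0"
      using W2sq_finite_trans W2sq_finite_imp_Pm unfolding P2_iff by blast
    moreover have "(\<lambda>n. W2d (\<sigma> n) \<mu>) \<longlonglongrightarrow> 0"
    proof (rule Lim_null_comparison)
      show "\<forall>\<^sub>F n in sequentially. norm (W2d (\<sigma> n) \<mu>) \<le> 2 * (1/2) ^ n"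
        using W2d_le[OF \<mu>] by (intro always_eventually allI) (simp add: W2d_nonneg)
      show "(\<lambda>n. 2 * (1/2) ^ n :: real) \<longlonglongrightarrow> 0"
        by (intro tendsto_mult_right_zero LIMSEQ_power_zero) simp
    qed
    ultimately show "\<exists>\<mu>. limitin mtopology \<sigma> \<mu> sequentially"
      using \<sigma> by (auto simp: limitin_metric_dist_null)
  qed
qed

lemma transport_plansD:
  assumes "w \<in> transport_plans \<omega> \<mu>0 \<mu>1"
  shows "prob_space w" "fst \<in> borel_measurable w" "(\<lambda>p. fst (snd p)) \<in> borel_measurable w"
    "(\<lambda>p. snd (snd p)) \<in> borel_measurable w"
    "distr w borel fst = \<omega>" "distr w borel (\<lambda>p. fst (snd p)) = \<mu>0" "distr w borel (\<lambda>p. snd (snd p)) = \<mu>1"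
    "mean_square w (\<lambda>p. fst p - fst (snd p)) = W2sq \<omega> \<mu>0"
    "mean_square w (\<lambda>p. fst p - snd (snd p)) = W2sq \<omega> \<mu>1"
proof -
  show prob: "prob_space w" using assms by (simp add: transport_plans_def)
  have sets: "sets w = sets borel" using assms by (simp add: transport_plans_def)
  show fst: "fst \<in> borel_measurable w" and fst_snd: "(\<lambda>p. fst (snd p)) \<in> borel_measurable w"
    and snd_snd: "(\<lambda>p. snd (snd p)) \<in> borel_measurable w"
    unfolding measurable_cong_sets[OF sets refl]
    by (intro fst_borel_measurable measurable_compose[OF snd_borel_measurable fst_borel_measurable]
        measurable_compose[OF snd_borel_measurable snd_borel_measurable])+
  have opt: "distr w borel (\<lambda>p. (fst p, fst (snd p))) \<in> optimal_couplings \<omega> \<mu>0"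
    "distr w borel (\<lambda>p. (fst p, snd (snd p))) \<in> optimal_couplings \<omega> \<mu>1"
    using assms by (simp_all add: transport_plans_def case_prod_beta')
  note pair = distr_Pair_in_couplings[OF prob fst]
  show "distr w borel fst = \<omega>" "distr w borel (\<lambda>p. fst (snd p)) = \<mu>0"
    using opt(1) pair[OF fst_snd] by (simp_all add: optimal_couplings_def couplings_def)
  show "distr w borel (\<lambda>p. snd (snd p)) = \<mu>1"
    using opt(2) pair[OF snd_snd] by (simp_all add: optimal_couplings_def couplings_def)
  show "mean_square w (\<lambda>p. fst p - fst (snd p)) = W2sq \<omega> \<mu>0"
    "mean_square w (\<lambda>p. fst p - snd (snd p)) = W2sq \<omega> \<mu>1"
    using opt cost2_distr_Pair[OF fst fst_snd] cost2_distr_Pair[OF fst snd_snd]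
    by (simp_all add: optimal_couplings_def)
qed

lemma W2plan_sq_eq_mean_square: "W2plan_sq w = mean_square w (\<lambda>p. fst (snd p) - snd (snd p))"
  by (simp add: W2plan_sq_def mean_square_def)

lemma W2sq_le_W2plan_sq:
  assumes "w \<in> transport_plans \<omega> \<mu>0 \<mu>1"
  shows "W2sq \<mu>0 \<mu>1 \<le> W2plan_sq w"
  using W2sq_distr_le[OF transport_plansD(1,3,4)[OF assms]]
  by (simp add: transport_plansD[OF assms] W2plan_sq_eq_mean_square)

lemma W2plan_sq_finite:
  assumes w: "w \<in> transport_plans \<omega> \<mu>0 \<mu>1" and fin: "W2sq \<omega> \<mu>0 < \<infinity>" "W2sq \<omega> \<mu>1 < \<infinity>"
  shows "W2plan_sq w < \<infinity>"
proof -
  note plan = transport_plansD[OF w]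
  have "mean_square w (\<lambda>p. fst (snd p) - fst p) \<le> ennreal ((W2d \<omega> \<mu>0)\<^sup>2)"
    using fin(1) by (simp add: mean_square_minus_commute[of w "\<lambda>p. fst (snd p)"] plan(8) W2sq_eq_W2d)
  moreover have "mean_square w (\<lambda>p. fst p - snd (snd p)) \<le> ennreal ((W2d \<omega> \<mu>1)\<^sup>2)"
    using fin(2) by (simp add: plan(9) W2sq_eq_W2d)
  ultimately have "mean_square w (\<lambda>p. (fst (snd p) - fst p) + (fst p - snd (snd p))) \<le>
      ennreal ((W2d \<omega> \<mu>0 + W2d \<omega> \<mu>1)\<^sup>2)"
    by (intro mean_square_add_le borel_measurable_diff plan W2d_nonneg)
  then show ?thesis by (simp add: W2plan_sq_eq_mean_square order_le_less_trans)
qed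

lemma W2sq_gen_geod_le:
  assumes w: "w \<in> transport_plans \<omega> \<mu>0 \<mu>1" and "0 \<le> \<alpha>" "\<alpha> \<le> 1"
  shows "W2sq \<omega> (gen_geod w \<alpha>) + ennreal (\<alpha> * (1 - \<alpha>)) * W2plan_sq w \<le>
      ennreal (1 - \<alpha>) * W2sq \<omega> \<mu>0 + ennreal \<alpha> * W2sq \<omega> \<mu>1"
proof -
  note plan = transport_plansD[OF w]
  have "(\<lambda>p. (1 - \<alpha>) *\<^sub>R fst (snd p) + \<alpha> *\<^sub>R snd (snd p)) \<in> borel_measurable w"
    by (intro borel_measurable_add borel_measurable_scaleR borel_measurable_const plan)
  from W2sq_distr_le[OF plan(1,2) this]
  have "W2sq \<omega> (gen_geod w \<alpha>) \<le> mean_square w (\<lambda>p. fst p - ((1 - \<alpha>) *\<^sub>R fst (snd p) + \<alpha> *\<^sub>R snd (snd p)))"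
    by (simp add: plan(5) gen_geod_def case_prod_beta')
  then show ?thesis
    unfolding W2plan_sq_eq_mean_square plan(8)[symmetric] plan(9)[symmetric]
      mean_square_convex_combination[OF plan(2,3,4) assms(2,3), symmetric]
    by (rule add_right_mono)
qed

lemma gen_geod_in_P2:
  assumes w: "w \<in> transport_plans \<omega> \<mu>0 \<mu>1" and P2: "\<omega> \<in> P2 \<omega>0" "\<mu>0 \<in> P2 \<omega>0" "\<mu>1 \<in> P2 \<omega>0"
    and "0 \<le> \<alpha>" "\<alpha> \<le> 1"
  shows "gen_geod w \<alpha> \<in> P2 \<omega>0"
proof -
  have "W2sq \<omega> (gen_geod w \<alpha>) \<le> ennreal (1 - \<alpha>) * W2sq \<omega> \<mu>0 + ennreal \<alpha> * W2sq \<omega> \<mu>1"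
    using W2sq_gen_geod_le[OF w assms(5,6)] by (rule order_trans[rotated]) simp
  also have "\<dots> < \<infinity>" using W2sq_finite[OF P2(1,2)] W2sq_finite[OF P2(1,3)]
    by (simp add: ennreal_mult_less_top)
  finally have "W2sq (gen_geod w \<alpha>) \<omega> < \<infinity>" by (simp add: W2sq_commute[of _ \<omega>])
  then show ?thesis
    using W2sq_finite_trans[of "gen_geod w \<alpha>" \<omega> \<omega>0] W2sq_finite_imp_Pm P2(1) by (auto simp: P2_iff)
qed

section \<open>Proximal points of convex energies\<close>

context Metric_space
begin

text \<open>\<open>g\<close> plays the role of a generalized geodesic with base \<open>x\<close>, and \<open>q\<close> that of its squared plan
  distance \<open>W\<^sup>2\<^bsub>2,\<omega>\<^esub>(v\<^sub>0, v\<^sub>1)\<close>.\<close>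

definition generalized_geodesic :: "'a \<Rightarrow> 'a \<Rightarrow> 'a \<Rightarrow> real \<Rightarrow> (real \<Rightarrow> 'a) \<Rightarrow> bool" where
  "generalized_geodesic x v\<^sub>0 v\<^sub>1 q g \<longleftrightarrow> (d v\<^sub>0 v\<^sub>1)\<^sup>2 \<le> q \<and> (\<forall>\<alpha>\<in>{0..1}. g \<alpha> \<in> M \<and>
    (d x (g \<alpha>))\<^sup>2 \<le> (1 - \<alpha>) * (d x v\<^sub>0)\<^sup>2 + \<alpha> * (d x v\<^sub>1)\<^sup>2 - \<alpha> * (1 - \<alpha>) * q)"

lemma generalized_geodesic_from_base:
  assumes g: "generalized_geodesic x x v q g" and x: "x \<in> M" and \<alpha>: "0 < \<alpha>" "\<alpha> \<le> 1"
  shows "d x (g \<alpha>) \<le> \<alpha> * d x v" and "(1 - \<alpha>) * q \<le> (d x v)\<^sup>2"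
proof -
  have q: "(d x v)\<^sup>2 \<le> q" and "(d x (g \<alpha>))\<^sup>2 \<le> (1 - \<alpha>) * (d x x)\<^sup>2 + \<alpha> * (d x v)\<^sup>2 - \<alpha> * (1 - \<alpha>) * q"
    using g \<alpha> by (auto simp: generalized_geodesic_def)
  then have dist: "(d x (g \<alpha>))\<^sup>2 \<le> \<alpha> * ((d x v)\<^sup>2 - (1 - \<alpha>) * q)"
    using x by (simp add: algebra_simps)
  also have "\<dots> \<le> \<alpha> * ((d x v)\<^sup>2 - (1 - \<alpha>) * (d x v)\<^sup>2)"
    using q \<alpha> by (intro mult_left_mono diff_left_mono) auto
  also have "\<dots> = (\<alpha> * d x v)\<^sup>2" by (simp add: power2_eq_square algebra_simps)
  finally show "d x (g \<alpha>) \<le> \<alpha> * d x v" by (rule power2_le_imp_le) (use \<alpha> in simp)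
  have "0 \<le> \<alpha> * ((d x v)\<^sup>2 - (1 - \<alpha>) * q)" using dist zero_le_power2 by (rule order_trans[rotated])
  then show "(1 - \<alpha>) * q \<le> (d x v)\<^sup>2" using \<alpha> by (simp add: zero_le_mult_iff)
qed

end

text \<open>\<open>D\<close> is the effective domain of the energy, \<open>e\<close> its real-valued restriction, and \<open>a\<close> stands for \<open>\<lambda>\<^sup>-\<close>.\<close>

locale convex_energy = Metric_space M d for M :: "'a set" and d +
  fixes D :: "'a set" and e :: "'a \<Rightarrow> real" and a :: real
  assumes D_subset: "D \<subseteq> M" and complete: mcomplete and a_nonneg: "0 \<le> a"
    and lsc: "\<And>\<sigma> x c l. \<lbrakk>\<And>n. \<sigma> n \<in> D; limitin mtopology \<sigma> x sequentially; \<And>n. e (\<sigma> n) \<le> c n; c \<longlonglongrightarrow> l\<rbrakk>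
          \<Longrightarrow> x \<in> D \<and> e x \<le> l"
    and convex: "\<And>x v\<^sub>0 v\<^sub>1. \<lbrakk>x \<in> D; v\<^sub>0 \<in> D; v\<^sub>1 \<in> D\<rbrakk> \<Longrightarrow> \<exists>g q. generalized_geodesic x v\<^sub>0 v\<^sub>1 q g \<and>
          (\<forall>\<alpha>\<in>{0..1}. g \<alpha> \<in> D \<and> e (g \<alpha>) \<le> (1 - \<alpha>) * e v\<^sub>0 + \<alpha> * e v\<^sub>1 + \<alpha> * (1 - \<alpha>) * (a / 2) * q)"
begin

lemma D_imp_M: "x \<in> D \<Longrightarrow> x \<in> M"
  using D_subset by blast

definition slope_le :: "'a \<Rightarrow> real \<Rightarrow> bool" where
  "slope_le \<mu> L \<longleftrightarrow> (\<forall>L'>L. \<exists>\<delta>>0. \<forall>\<nu>\<in>D. 0 < d \<mu> \<nu> \<and> d \<mu> \<nu> < \<delta> \<longrightarrow> e \<mu> - e \<nu> \<le> L' * d \<mu> \<nu>)"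

lemma energy_drop_le_if_locally:
  assumes \<mu>: "\<mu> \<in> D" and \<nu>: "\<nu> \<in> D" and "0 < \<delta>" "0 \<le> L"
    and local: "\<And>\<nu>. \<nu> \<in> D \<Longrightarrow> 0 < d \<mu> \<nu> \<Longrightarrow> d \<mu> \<nu> < \<delta> \<Longrightarrow> e \<mu> - e \<nu> \<le> L * d \<mu> \<nu>"
  shows "e \<mu> - e \<nu> \<le> L * d \<mu> \<nu> + a / 2 * (d \<mu> \<nu>)\<^sup>2"
proof -
  obtain g q where g: "generalized_geodesic \<mu> \<mu> \<nu> q g" and energy: "\<forall>\<alpha>\<in>{0..1}. g \<alpha> \<in> D \<and>
      e (g \<alpha>) \<le> (1 - \<alpha>) * e \<mu> + \<alpha> * e \<nu> + \<alpha> * (1 - \<alpha>) * (a / 2) * q"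
    using convex[OF \<mu> \<mu> \<nu>] by blast
  have "((\<lambda>\<alpha>. \<alpha> * d \<mu> \<nu>) \<longlongrightarrow> 0 * d \<mu> \<nu>) (at_right 0)" by (intro tendsto_intros)
  then have "\<forall>\<^sub>F \<alpha> in at_right 0. \<alpha> * d \<mu> \<nu> < \<delta>" using \<open>0 < \<delta>\<close> by (intro order_tendstoD(2)) auto
  moreover have "\<forall>\<^sub>F \<alpha> in at_right (0::real). 0 < \<alpha> \<and> \<alpha> \<le> 1"
    by (auto simp: eventually_at_right_field intro!: exI[of _ 1])
  ultimately have "\<forall>\<^sub>F \<alpha> in at_right 0. 0 < \<alpha> \<and> \<alpha> \<le> 1 \<and> \<alpha> * d \<mu> \<nu> < \<delta>" by eventually_elim simp
  then obtain \<alpha> where \<alpha>: "0 < \<alpha>" "\<alpha> \<le> 1" "\<alpha> * d \<mu> \<nu> < \<delta>"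
    using eventually_happens'[OF trivial_limit_at_right_real] by blast
  note g_\<alpha> = generalized_geodesic_from_base[OF g D_imp_M[OF \<mu>] \<alpha>(1,2)]
  have g_D: "g \<alpha> \<in> D" using energy \<alpha> by simp
  have "e \<mu> - e (g \<alpha>) \<le> L * d \<mu> (g \<alpha>)"
  proof (cases "d \<mu> (g \<alpha>) = 0")
    case True
    then show ?thesis using D_imp_M \<mu> g_D by simp
  next
    case False
    then show ?thesis using local[OF g_D] g_\<alpha>(1) \<alpha>(3) nonneg[of \<mu> "g \<alpha>"] by linarith
  qed
  also have "\<dots> \<le> L * (\<alpha> * d \<mu> \<nu>)" using g_\<alpha>(1) \<open>0 \<le> L\<close> by (rule mult_left_mono)
  finally have "e \<mu> - e (g \<alpha>) \<le> L * (\<alpha> * d \<mu> \<nu>)" .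
  moreover have "e (g \<alpha>) \<le> (1 - \<alpha>) * e \<mu> + \<alpha> * e \<nu> + \<alpha> * ((1 - \<alpha>) * q) * (a / 2)"
    using energy \<alpha> by (simp add: mult_ac)
  moreover have "\<alpha> * ((1 - \<alpha>) * q) * (a / 2) \<le> \<alpha> * (d \<mu> \<nu>)\<^sup>2 * (a / 2)"
    using g_\<alpha>(2) \<alpha> a_nonneg by (intro mult_right_mono mult_left_mono) auto
  ultimately have "\<alpha> * (e \<mu> - e \<nu>) \<le> \<alpha> * (L * d \<mu> \<nu> + a / 2 * (d \<mu> \<nu>)\<^sup>2)"
    by (simp add: algebra_simps)
  then show ?thesis using \<alpha> by simp
qed

lemma energy_drop_le:
  assumes \<mu>: "\<mu> \<in> D" "slope_le \<mu> L" and "0 \<le> L" and \<nu>: "\<nu> \<in> D"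
  shows "e \<mu> - e \<nu> \<le> L * d \<mu> \<nu> + a / 2 * (d \<mu> \<nu>)\<^sup>2"
proof (rule tendsto_lowerbound)
  show "((\<lambda>L'. L' * d \<mu> \<nu> + a / 2 * (d \<mu> \<nu>)\<^sup>2) \<longlongrightarrow> L * d \<mu> \<nu> + a / 2 * (d \<mu> \<nu>)\<^sup>2) (at_right L)"
    by (intro tendsto_intros)
  have "e \<mu> - e \<nu> \<le> L' * d \<mu> \<nu> + a / 2 * (d \<mu> \<nu>)\<^sup>2" if L': "L < L'" for L'
  proof -
    obtain \<delta> where "0 < \<delta>" "\<forall>\<nu>\<in>D. 0 < d \<mu> \<nu> \<and> d \<mu> \<nu> < \<delta> \<longrightarrow> e \<mu> - e \<nu> \<le> L' * d \<mu> \<nu>"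
      using \<mu>(2) L' unfolding slope_le_def by blast
    then show ?thesis using \<open>0 \<le> L\<close> L' by (intro energy_drop_le_if_locally[OF \<mu>(1) \<nu>]) auto
  qed
  then show "\<forall>\<^sub>F L' in at_right L. e \<mu> - e \<nu> \<le> L' * d \<mu> \<nu> + a / 2 * (d \<mu> \<nu>)\<^sup>2"
    by (simp add: eventually_at_filter)
qed simp

definition proximal_energy :: "real \<Rightarrow> 'a \<Rightarrow> 'a \<Rightarrow> real" where
  "proximal_energy h x v = (d x v)\<^sup>2 / (2 * h) + e v"

definition is_prox :: "real \<Rightarrow> 'a \<Rightarrow> 'a \<Rightarrow> bool" where
  "is_prox h x y \<longleftrightarrow> y \<in> D \<and> (\<forall>v\<in>D. proximal_energy h x y \<le> proximal_energy h x v)"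

lemma proximal_energy_strongly_convex:
  assumes D: "x \<in> D" "v \<in> D" "w \<in> D" and h: "0 < h" "a * h \<le> 1" and \<alpha>: "0 \<le> \<alpha>" "\<alpha> \<le> 1"
  obtains z where "z \<in> D" "proximal_energy h x z \<le>
    (1 - \<alpha>) * proximal_energy h x v + \<alpha> * proximal_energy h x w -
    \<alpha> * (1 - \<alpha>) * ((1 / h - a) / 2 * (d v w)\<^sup>2)"
proof -
  obtain g q where g: "generalized_geodesic x v w q g" and energy: "\<forall>\<alpha>\<in>{0..1}. g \<alpha> \<in> D \<and>
      e (g \<alpha>) \<le> (1 - \<alpha>) * e v + \<alpha> * e w + \<alpha> * (1 - \<alpha>) * (a / 2) * q"
    using convex[OF D] by blast
  have "(d x (g \<alpha>))\<^sup>2 \<le> (1 - \<alpha>) * (d x v)\<^sup>2 + \<alpha> * (d x w)\<^sup>2 - \<alpha> * (1 - \<alpha>) * q"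
    using g \<alpha> by (simp add: generalized_geodesic_def)
  then have "(d x (g \<alpha>))\<^sup>2 / (2 * h) \<le> ((1 - \<alpha>) * (d x v)\<^sup>2 + \<alpha> * (d x w)\<^sup>2 - \<alpha> * (1 - \<alpha>) * q) / (2 * h)"
    using h by (intro divide_right_mono) auto
  moreover have "e (g \<alpha>) \<le> (1 - \<alpha>) * e v + \<alpha> * e w + \<alpha> * (1 - \<alpha>) * (a / 2) * q" using energy \<alpha> by simp
  ultimately have "proximal_energy h x (g \<alpha>) \<le>
      ((1 - \<alpha>) * (d x v)\<^sup>2 + \<alpha> * (d x w)\<^sup>2 - \<alpha> * (1 - \<alpha>) * q) / (2 * h) +
      ((1 - \<alpha>) * e v + \<alpha> * e w + \<alpha> * (1 - \<alpha>) * (a / 2) * q)"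
    unfolding proximal_energy_def by (rule add_mono)
  also have "\<dots> = (1 - \<alpha>) * proximal_energy h x v + \<alpha> * proximal_energy h x w -
      \<alpha> * (1 - \<alpha>) * ((1 / h - a) / 2 * q)"
    using h by (simp add: proximal_energy_def field_simps)
  also have "\<dots> \<le> (1 - \<alpha>) * proximal_energy h x v + \<alpha> * proximal_energy h x w -
      \<alpha> * (1 - \<alpha>) * ((1 / h - a) / 2 * (d v w)\<^sup>2)"
  proof (intro diff_left_mono mult_left_mono)
    show "(d v w)\<^sup>2 \<le> q" using g by (simp add: generalized_geodesic_def)
    show "0 \<le> (1 / h - a) / 2" using h by (simp add: field_simps)
  qed (use \<alpha> in auto)
  finally have "proximal_energy h x (g \<alpha>) \<le> (1 - \<alpha>) * proximal_energy h x v + \<alpha> * proximal_energy h x w -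
      \<alpha> * (1 - \<alpha>) * ((1 / h - a) / 2 * (d v w)\<^sup>2)" .
  moreover have "g \<alpha> \<in> D" using energy \<alpha> by simp
  ultimately show ?thesis by (rule that[rotated])
qed

lemma prox_quadratic_growth:
  assumes x: "x \<in> D" and h: "0 < h" "a * h \<le> 1" and y: "is_prox h x y" and v: "v \<in> D"
  shows "proximal_energy h x y + (1 / h - a) / 2 * (d y v)\<^sup>2 \<le> proximal_energy h x v"
proof -
  define K where "K = (1 / h - a) / 2 * (d y v)\<^sup>2"
  have "(1 - \<alpha>) * K \<le> proximal_energy h x v - proximal_energy h x y" if \<alpha>: "0 < \<alpha>" "\<alpha> \<le> 1" for \<alpha>
  proof -
    have "y \<in> D" using y by (simp add: is_prox_def)
    then obtain z where z: "z \<in> D" "proximal_energy h x z \<le>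
        (1 - \<alpha>) * proximal_energy h x y + \<alpha> * proximal_energy h x v - \<alpha> * (1 - \<alpha>) * K"
      using proximal_energy_strongly_convex[OF x _ v h, of y \<alpha>] \<alpha> unfolding K_def by auto
    have "proximal_energy h x y \<le> proximal_energy h x z" using y z(1) by (simp add: is_prox_def)
    then have "\<alpha> * ((1 - \<alpha>) * K) \<le> \<alpha> * (proximal_energy h x v - proximal_energy h x y)"
      using z(2) by (simp add: algebra_simps)
    then show ?thesis using \<alpha> by simp
  qed
  then have "\<forall>\<^sub>F \<alpha> in at_right 0. (1 - \<alpha>) * K \<le> proximal_energy h x v - proximal_energy h x y"
    by (auto simp: eventually_at_right_field intro!: exI[of _ 1])
  moreover have "((\<lambda>\<alpha>. (1 - \<alpha>) * K) \<longlongrightarrow> (1 - 0) * K) (at_right 0)" by (intro tendsto_intros)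
  ultimately have "(1 - 0) * K \<le> proximal_energy h x v - proximal_energy h x y"
    by (intro tendsto_upperbound[where F = "at_right (0::real)"]) auto
  then show ?thesis unfolding K_def[symmetric] by simp
qed

lemma prox_variational_inequality:
  assumes "x \<in> D" and h: "0 < h" "a * h \<le> 1" and "is_prox h x y" "v \<in> D"
  shows "(1 - a * h) * (d y v)\<^sup>2 - (d x v)\<^sup>2 + (d x y)\<^sup>2 \<le> 2 * h * (e v - e y)"
proof -
  define c where "c = (1 / h - a) / 2 * (d y v)\<^sup>2"
  have scale: "2 * h * proximal_energy h x z = (d x z)\<^sup>2 + 2 * h * e z" for z
    using h by (simp add: proximal_energy_def distrib_left)
  have "2 * h * (proximal_energy h x y + c) \<le> 2 * h * proximal_energy h x v"
    using prox_quadratic_growth[OF assms] h by (intro mult_left_mono) (auto simp: c_def)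
  moreover have "2 * h * c = (1 - a * h) * (d y v)\<^sup>2"
    using h by (simp add: c_def field_simps)
  ultimately show ?thesis
    by (simp only: distrib_left right_diff_distrib scale)
qed

lemma proximal_energy_bdd_below:
  assumes \<mu>: "\<mu> \<in> D" "slope_le \<mu> L" "0 \<le> L" and x: "x \<in> D" and h: "0 < h" "a * h \<le> 1/2"
  shows "bdd_below (proximal_energy h x ` D)"
proof (rule bdd_belowI2)
  fix v assume v: "v \<in> D"
  define r c b where "r = d x v" and "c = d \<mu> x" and "b = L + a * c"
  have "d \<mu> v \<le> c + r" using triangle D_imp_M \<mu>(1) x v by (simp add: r_def c_def)
  then have "L * d \<mu> v + a / 2 * (d \<mu> v)\<^sup>2 \<le> L * (c + r) + a / 2 * (c + r)\<^sup>2"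
    using \<mu>(3) a_nonneg by (intro add_mono mult_left_mono power_mono) auto
  then have "e \<mu> - (L * (c + r) + a / 2 * (c + r)\<^sup>2) \<le> e v"
    using energy_drop_le[OF \<mu> v] by linarith
  moreover have "b * r + a / 2 * r\<^sup>2 - h * b\<^sup>2 \<le> r\<^sup>2 / (2 * h)"
  proof -
    have "0 \<le> (r / (2 * h) - b)\<^sup>2 * h" using h by simp
    also have "\<dots> = r\<^sup>2 / (4 * h) - b * r + h * b\<^sup>2" using h by (simp add: power2_eq_square field_simps)
    finally have "b * r - h * b\<^sup>2 \<le> r\<^sup>2 / (4 * h)" by simp
    moreover have "a / 2 * r\<^sup>2 \<le> r\<^sup>2 / (4 * h)"
      using mult_right_mono[OF h(2), of "r\<^sup>2"] h(1) by (simp add: field_simps)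
    ultimately show ?thesis by (simp add: field_simps)
  qed
  ultimately show "e \<mu> - L * d \<mu> x - a / 2 * (d \<mu> x)\<^sup>2 - h * (L + a * d \<mu> x)\<^sup>2 \<le> proximal_energy h x v"
    unfolding proximal_energy_def r_def[symmetric] c_def[symmetric] b_def[symmetric]
    by (simp add: b_def power2_eq_square algebra_simps)
qed

lemma near_minimizers_dist_square_le:
  assumes D: "x \<in> D" "v \<in> D" "w \<in> D" and h: "0 < h" "a * h < 1"
    and lower: "\<And>z. z \<in> D \<Longrightarrow> I \<le> proximal_energy h x z"
    and near: "proximal_energy h x v \<le> I + r" "proximal_energy h x w \<le> I + s"
  shows "(d v w)\<^sup>2 \<le> 4 / (1 / h - a) * r + 4 / (1 / h - a) * s"
proof -
  obtain z where z: "z \<in> D" "proximal_energy h x z \<le> (1 - 1/2) * proximal_energy h x v +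
      1/2 * proximal_energy h x w - 1/2 * (1 - 1/2) * ((1 / h - a) / 2 * (d v w)\<^sup>2)"
    using proximal_energy_strongly_convex[OF D h(1), of "1/2"] h(2) by auto
  have "(1 / h - a) * (d v w)\<^sup>2 \<le> 4 * r + 4 * s"
    using lower[OF z(1)] z(2) near by argo
  moreover have "0 < 1 / h - a" using h by (simp add: field_simps)
  ultimately have "(d v w)\<^sup>2 \<le> (4 * r + 4 * s) / (1 / h - a)"
    by (simp only: pos_le_divide_eq mult.commute)
  then show ?thesis by (simp add: add_divide_distrib)
qed

lemma is_prox_exists:
  assumes x: "x \<in> D" and h: "0 < h" "a * h < 1" and bdd: "bdd_below (proximal_energy h x ` D)"
  shows "\<exists>y. is_prox h x y"
proof -
  define I where "I = Inf (proximal_energy h x ` D)"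
  have I_le: "I \<le> proximal_energy h x v" if "v \<in> D" for v
    unfolding I_def using bdd that by (intro cInf_lower) auto
  have "\<exists>v\<in>D. proximal_energy h x v < I + 1 / real (Suc n)" for n
    using cInf_less_iff[of "proximal_energy h x ` D" "I + 1 / real (Suc n)"] bdd x by (auto simp: I_def)
  then obtain \<sigma> where \<sigma>: "\<And>n. \<sigma> n \<in> D" "\<And>n. proximal_energy h x (\<sigma> n) < I + 1 / real (Suc n)" by metis
  obtain y where y: "limitin mtopology \<sigma> y sequentially"
  proof (rule limitin_if_dist_square_le[OF complete, of 0 \<sigma>])
    show "\<sigma> n \<in> M" for n by (rule D_imp_M[OF \<sigma>(1)])
    show "(d (\<sigma> m) (\<sigma> n))\<^sup>2 \<le> 4 / (1 / h - a) * (1 / real (Suc m)) + 4 / (1 / h - a) * (1 / real (Suc n))"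
      for m n
      using \<sigma> by (intro near_minimizers_dist_square_le[OF x _ _ h I_le] less_imp_le)
    show "(\<lambda>n. 4 / (1 / h - a) * (1 / real (Suc n))) \<longlonglongrightarrow> 0"
      by (intro tendsto_mult_right_zero LIMSEQ_Suc[OF lim_1_over_n])
  qed
  have y_D: "y \<in> D \<and> e y \<le> I + 0 - (d x y)\<^sup>2 / (2 * h)"
  proof (rule lsc[OF \<sigma>(1) y])
    show "e (\<sigma> n) \<le> I + 1 / real (Suc n) - (d x (\<sigma> n))\<^sup>2 / (2 * h)" for n
      using \<sigma>(2)[of n] by (simp add: proximal_energy_def)
    show "(\<lambda>n. I + 1 / real (Suc n) - (d x (\<sigma> n))\<^sup>2 / (2 * h)) \<longlonglongrightarrow> I + 0 - (d x y)\<^sup>2 / (2 * h)"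
      using h by (intro tendsto_intros tendsto_dist_if_limitin[OF y D_imp_M[OF x]]
          LIMSEQ_Suc[OF lim_1_over_n]) auto
  qed
  then have "proximal_energy h x y \<le> I" by (simp add: proximal_energy_def)
  then show ?thesis
    unfolding is_prox_def using y_D order_trans[OF _ I_le] by blast
qed

lemma prox_displacement_le:
  assumes \<mu>: "\<mu> \<in> D" "slope_le \<mu> L" "0 \<le> L" and x: "x \<in> D" and h: "0 < h" "a * h \<le> 1/2"
    and y: "is_prox h x y"
  shows "(1 - a * h) * d y \<mu> \<le> d x \<mu> + h * L"
proof -
  have y_D: "y \<in> D" using y by (simp add: is_prox_def)
  define u v where "u = d x \<mu>" and "v = d y \<mu>"
  have "(1 - a * h) * v\<^sup>2 - u\<^sup>2 + (d x y)\<^sup>2 \<le> 2 * h * (e \<mu> - e y)"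
    using prox_variational_inequality[OF x h(1) _ y \<mu>(1)] h(2) by (simp add: u_def v_def)
  also have "\<dots> \<le> 2 * h * (L * v + a / 2 * v\<^sup>2)"
    using energy_drop_le[OF \<mu> y_D] h commute[of \<mu>] by (intro mult_left_mono) (auto simp: v_def)
  finally have "(1 - a * h) * v\<^sup>2 - u\<^sup>2 + (d x y)\<^sup>2 \<le> 2 * h * (L * v + a / 2 * v\<^sup>2)" .
  \<comment> \<open>Without \<open>d(x,y)\<^sup>2\<close> the coefficient of \<open>v\<^sup>2\<close> would be \<open>1 - 2 a h\<close>, which vanishes at \<open>a h = 1/2\<close>.\<close>
  moreover have "(v - u)\<^sup>2 \<le> (d x y)\<^sup>2"
    using mdist_reverse_triangle[of y \<mu> x] D_imp_M x y_D \<mu>(1)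
    by (simp add: u_def v_def commute power2_le_iff_abs_le)
  ultimately have "2 * v * ((1 - a * h) * v) \<le> 2 * v * (u + h * L)"
    by (simp add: power2_eq_square algebra_simps)
  moreover have "0 \<le> u + h * L" "0 \<le> v" using h \<mu>(3) by (auto simp: u_def v_def)
  ultimately show ?thesis unfolding u_def[symmetric] v_def[symmetric] by (cases "v = 0") auto
qed

end

section \<open>Discrete flows\<close>

definition kobayashi_bound :: "real \<Rightarrow> real \<Rightarrow> real \<Rightarrow> real \<Rightarrow> real \<Rightarrow> real" where
  "kobayashi_bound a H K t s = ((t - s)\<^sup>2 + H * t + K * s) * exp (4 * a * (t + s))"

lemma kobayashi_bound_commute: "kobayashi_bound a H K t s = kobayashi_bound a K H s t"
  by (simp add: kobayashi_bound_def power2_commute add_ac)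

lemma square_le_kobayashi_bound_0:
  assumes "0 \<le> u" "u \<le> L * (t * exp (2 * a * t))" "0 \<le> t" "0 \<le> H"
  shows "u\<^sup>2 \<le> L\<^sup>2 * kobayashi_bound a H K t 0"
proof -
  have "u\<^sup>2 \<le> (L * (t * exp (2 * a * t)))\<^sup>2" using assms by (intro power_mono)
  also have "\<dots> = L\<^sup>2 * (t\<^sup>2 * exp (4 * a * t))" by (simp add: power_mult_distrib exp_double[symmetric])
  also have "\<dots> \<le> L\<^sup>2 * ((t\<^sup>2 + H * t) * exp (4 * a * t))"
    using assms by (intro mult_left_mono mult_right_mono) auto
  finally show ?thesis by (simp add: kobayashi_bound_def)
qed

lemma exp_decay_le_kobayashi_factor:
  fixes a h k :: real
  assumes "0 \<le> a" "0 < h" "0 < k" "a * k \<le> 1/2"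
  shows "(h + k) * exp (- (4 * a * h)) \<le> h + k - 2 * a * h * k"
proof -
  have "0 \<le> 2 * (a * h) * h * (1 - 2 * (a * k))" using assms by simp
  then have "h + k \<le> (h + k - 2 * a * h * k) * (1 + 2 * a * h)" by (simp add: algebra_simps)
  also have "\<dots> \<le> (h + k - 2 * a * h * k) * exp (4 * a * h)"
  proof (rule mult_left_mono)
    have "1 + 2 * a * h \<le> 1 + 4 * a * h" using assms by simp
    also have "\<dots> \<le> exp (4 * a * h)" by (rule exp_ge_add_one_self)
    finally show "1 + 2 * a * h \<le> exp (4 * a * h)" .
    have "2 * a * h * k \<le> h" using mult_left_mono[OF assms(4), of "2 * h"] assms(2)
      by (simp add: mult_ac)
    then show "0 \<le> h + k - 2 * a * h * k" using assms by linarith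
  qed
  finally show ?thesis by (simp add: exp_minus field_simps)
qed

lemma kobayashi_factor_pos:
  fixes a h k :: real
  assumes "0 \<le> a" "0 < h" "0 < k" "a * k \<le> 1/2"
  shows "0 < h + k - 2 * a * h * k"
proof -
  have "0 < (h + k) * exp (- (4 * a * h))" using assms by simp
  then show ?thesis using exp_decay_le_kobayashi_factor[OF assms] by linarith
qed

lemma kobayashi_bound_supersolution:
  assumes a: "0 \<le> a" and h: "0 < h" "a * h \<le> 1/2" "h \<le> H" "h \<le> t"
    and k: "0 < k" "a * k \<le> 1/2" "k \<le> K" "k \<le> s"
  shows "k * kobayashi_bound a H K (t - h) s + h * kobayashi_bound a H K t (s - k) \<le>
    (h + k - 2 * a * h * k) * kobayashi_bound a H K t s"
proof -
  define E \<theta> where "E = exp (4 * a * (t + s))" and "\<theta> = h + k - 2 * a * h * k"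
  define b\<^sub>1 b\<^sub>2 b where "b\<^sub>1 = (t - h - s)\<^sup>2 + H * (t - h) + K * s"
    and "b\<^sub>2 = (t - (s - k))\<^sup>2 + H * t + K * (s - k)" and "b = (t - s)\<^sup>2 + H * t + K * s"
  have decay: "(h + k) * exp (- (4 * a * h)) \<le> \<theta>" "(h + k) * exp (- (4 * a * k)) \<le> \<theta>"
    using exp_decay_le_kobayashi_factor[OF a h(1) k(1,2)] exp_decay_le_kobayashi_factor[OF a k(1) h(1,2)]
    by (simp_all add: \<theta>_def add.commute mult_ac)
  have nonneg: "0 \<le> b\<^sub>1" "0 \<le> b\<^sub>2" using h k by (auto simp: b\<^sub>1_def b\<^sub>2_def intro!: add_nonneg_nonneg)
  have bound: "kobayashi_bound a H K (t - h) s = b\<^sub>1 * (exp (- (4 * a * h)) * E)"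
    "kobayashi_bound a H K t (s - k) = b\<^sub>2 * (exp (- (4 * a * k)) * E)"
    by (simp_all add: kobayashi_bound_def b\<^sub>1_def b\<^sub>2_def E_def exp_add[symmetric] algebra_simps)
  have "(h + k) * (k * kobayashi_bound a H K (t - h) s + h * kobayashi_bound a H K t (s - k)) =
      k * b\<^sub>1 * E * ((h + k) * exp (- (4 * a * h))) + h * b\<^sub>2 * E * ((h + k) * exp (- (4 * a * k)))"
    unfolding bound by (simp add: algebra_simps)
  also have "\<dots> \<le> k * b\<^sub>1 * E * \<theta> + h * b\<^sub>2 * E * \<theta>"
    using decay nonneg h k by (intro add_mono mult_left_mono) (auto simp: E_def)
  also have "\<dots> = (k * b\<^sub>1 + h * b\<^sub>2) * (E * \<theta>)" by (simp add: algebra_simps)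
  also have "\<dots> \<le> ((h + k) * b) * (E * \<theta>)"
  proof (rule mult_right_mono)
    have "(h + k) * b - (k * b\<^sub>1 + h * b\<^sub>2) = h * k * ((H - h) + (K - k))"
      by (simp add: b_def b\<^sub>1_def b\<^sub>2_def power2_eq_square algebra_simps)
    moreover have "0 \<le> h * k * ((H - h) + (K - k))" using h k by simp
    ultimately show "k * b\<^sub>1 + h * b\<^sub>2 \<le> (h + k) * b" by linarith
    show "0 \<le> E * \<theta>" using kobayashi_factor_pos[OF a h(1) k(1,2)] by (simp add: E_def \<theta>_def)
  qed
  also have "\<dots> = (h + k) * (\<theta> * kobayashi_bound a H K t s)"
    by (simp add: kobayashi_bound_def E_def b_def mult_ac)
  finally show ?thesis using h(1) k(1) by (simp add: \<theta>_def)
qed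

lemma kobayashi_bound_induct_step:
  assumes a: "0 \<le> a" and h: "0 < h" "a * h \<le> 1/2" "h \<le> H" "h \<le> t"
    and k: "0 < k" "a * k \<le> 1/2" "k \<le> K" "k \<le> s"
    and C: "0 \<le> C" and rec: "(h + k - 2 * a * h * k) * x \<le> k * x\<^sub>1 + h * x\<^sub>2"
    and x\<^sub>1: "x\<^sub>1 \<le> C * kobayashi_bound a H K (t - h) s" and x\<^sub>2: "x\<^sub>2 \<le> C * kobayashi_bound a H K t (s - k)"
  shows "x \<le> C * kobayashi_bound a H K t s"
proof -
  have "(h + k - 2 * a * h * k) * x \<le> k * (C * kobayashi_bound a H K (t - h) s) +
      h * (C * kobayashi_bound a H K t (s - k))"
    using h(1) k(1) by (intro order_trans[OF rec] add_mono mult_left_mono x\<^sub>1 x\<^sub>2) auto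
  also have "\<dots> = C * (k * kobayashi_bound a H K (t - h) s + h * kobayashi_bound a H K t (s - k))"
    by (simp add: algebra_simps)
  also have "\<dots> \<le> C * ((h + k - 2 * a * h * k) * kobayashi_bound a H K t s)"
    using C by (intro mult_left_mono kobayashi_bound_supersolution[OF a h k])
  finally have "(h + k - 2 * a * h * k) * x \<le> (h + k - 2 * a * h * k) * (C * kobayashi_bound a H K t s)"
    by (simp only: mult_ac)
  then show ?thesis using kobayashi_factor_pos[OF a h(1) k(1,2)] by (simp only: mult_le_cancel_left_pos)
qed

locale proximal_flow = convex_energy +
  fixes J :: "real \<Rightarrow> 'a \<Rightarrow> 'a" and \<mu> :: 'a and L :: real
  assumes J: "\<And>h x. \<lbrakk>0 < h; a * h \<le> 1/2; x \<in> D\<rbrakk> \<Longrightarrow> is_prox h x (J h x)"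
    and \<mu>: "\<mu> \<in> D" "slope_le \<mu> L" "0 \<le> L"
begin

definition flow :: "real list \<Rightarrow> 'a" where
  "flow hs = foldl (\<lambda>x h. J h x) \<mu> hs"

definition steps_le :: "real \<Rightarrow> real list \<Rightarrow> bool" where
  "steps_le H hs \<longleftrightarrow> 0 \<le> H \<and> (\<forall>h\<in>set hs. 0 < h \<and> h \<le> H \<and> a * h \<le> 1/2)"

lemma flow_Nil [simp]: "flow [] = \<mu>"
  and flow_snoc [simp]: "flow (hs @ [h]) = J h (flow hs)"
  by (simp_all add: flow_def)

lemma flow_replicate: "flow (replicate n h) = (J h ^^ n) \<mu>"
  by (induction n) (simp_all flip: replicate_append_same)

lemma steps_le_snoc [simp]: "steps_le H (hs @ [h]) \<longleftrightarrow> steps_le H hs \<and> 0 < h \<and> h \<le> H \<and> a * h \<le> 1/2"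
  by (auto simp: steps_le_def)

lemma steps_le_sum_list_nonneg: "steps_le H hs \<Longrightarrow> 0 \<le> sum_list hs"
  by (auto simp: steps_le_def intro!: sum_list_nonneg intro: less_imp_le)

lemma flow_in_D: "steps_le H hs \<Longrightarrow> flow hs \<in> D"
proof (induction hs rule: rev_induct)
  case (snoc h hs)
  then show ?case using J[of h "flow hs"] by (simp add: is_prox_def)
qed (simp add: \<mu>)

lemma flow_displacement_le:
  "steps_le H hs \<Longrightarrow> d (flow hs) \<mu> \<le> L * (sum_list hs * exp (2 * a * sum_list hs))"
proof (induction hs rule: rev_induct)
  case Nil
  then show ?case using D_imp_M[OF \<mu>(1)] by simp
next
  case (snoc h hs)
  define T G where "T = sum_list hs" and "G = exp (2 * a * T)"
  have h: "0 < h" "a * h \<le> 1/2" and hs: "steps_le H hs" using snoc.prems by auto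
  have G: "1 \<le> G" using steps_le_sum_list_nonneg[OF hs] a_nonneg by (simp add: G_def T_def)
  have factor: "1 \<le> exp (2 * (a * h)) * (1 - a * h)"
  proof -
    have "0 \<le> (a * h) * (1 - 2 * (a * h))" using a_nonneg h by simp
    then have "1 \<le> (1 + 2 * (a * h)) * (1 - a * h)" by (simp add: algebra_simps)
    also have "\<dots> \<le> exp (2 * (a * h)) * (1 - a * h)"
      using h by (intro mult_right_mono exp_ge_add_one_self) simp
    finally show ?thesis .
  qed
  have "d (J h (flow hs)) \<mu> \<le> exp (2 * (a * h)) * (1 - a * h) * d (J h (flow hs)) \<mu>"
    using mult_right_mono[OF factor, of "d (J h (flow hs)) \<mu>"] by simp
  also have "\<dots> = exp (2 * (a * h)) * ((1 - a * h) * d (J h (flow hs)) \<mu>)" by simp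
  also have "\<dots> \<le> exp (2 * (a * h)) * (L * (T * G) + L * (h * G))"
  proof (rule mult_left_mono)
    have "(1 - a * h) * d (J h (flow hs)) \<mu> \<le> d (flow hs) \<mu> + h * L"
      using flow_in_D[OF hs] by (intro prox_displacement_le \<mu> h J)
    also have "\<dots> \<le> L * (T * G) + L * (h * G)"
    proof (rule add_mono)
      show "d (flow hs) \<mu> \<le> L * (T * G)" using snoc.IH[OF hs] by (simp add: T_def G_def)
      show "h * L \<le> L * (h * G)" using G h \<mu>(3) mult_left_mono[OF G, of "L * h"] by (simp add: mult_ac)
    qed
    finally show "(1 - a * h) * d (J h (flow hs)) \<mu> \<le> L * (T * G) + L * (h * G)" .
  qed simp
  also have "\<dots> = L * ((T + h) * exp (2 * a * (T + h)))"
    by (simp add: G_def exp_add algebra_simps)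
  finally show ?case by (simp add: T_def)
qed

lemma flow_displacement_square_le:
  assumes "steps_le H hs"
  shows "(d (flow hs) \<mu>)\<^sup>2 \<le> L\<^sup>2 * kobayashi_bound a H K (sum_list hs) 0"
  using flow_displacement_le[OF assms] steps_le_sum_list_nonneg[OF assms] assms
  by (intro square_le_kobayashi_bound_0) (auto simp: steps_le_def)

lemma prox_pair_recursion:
  assumes D: "x \<in> D" "y \<in> D" and h: "0 < h" "a * h \<le> 1/2" and k: "0 < k" "a * k \<le> 1/2"
  shows "(h + k - 2 * a * h * k) * (d (J h x) (J k y))\<^sup>2 \<le> k * (d x (J k y))\<^sup>2 + h * (d (J h x) y)\<^sup>2"
proof -
  define x' y' where "x' = J h x" and "y' = J k y"
  have prox: "is_prox h x x'" "is_prox k y y'" using J D h k by (simp_all add: x'_def y'_def)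
  then have D': "x' \<in> D" "y' \<in> D" by (simp_all add: is_prox_def)
  have "(1 - a * h) * (d x' y')\<^sup>2 - (d x y')\<^sup>2 \<le> 2 * h * (e y' - e x')"
    using prox_variational_inequality[OF D(1) h(1) _ prox(1) D'(2)] h(2) zero_le_power2[of "d x x'"]
    by linarith
  from mult_left_mono[OF this, of k] k
  have "k * ((1 - a * h) * (d x' y')\<^sup>2 - (d x y')\<^sup>2) \<le> k * (2 * h * (e y' - e x'))" by simp
  moreover have "(1 - a * k) * (d x' y')\<^sup>2 - (d x' y)\<^sup>2 \<le> 2 * k * (e x' - e y')"
    using prox_variational_inequality[OF D(2) k(1) _ prox(2) D'(1)] k(2) zero_le_power2[of "d y y'"]
    unfolding commute[of x'] by linarith
  from mult_left_mono[OF this, of h] h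
  have "h * ((1 - a * k) * (d x' y')\<^sup>2 - (d x' y)\<^sup>2) \<le> h * (2 * k * (e x' - e y'))" by simp
  ultimately show ?thesis by (simp add: x'_def y'_def algebra_simps)
qed

lemma flow_dist_square_le:
  assumes "steps_le H hs" "steps_le K ks"
  shows "(d (flow hs) (flow ks))\<^sup>2 \<le> L\<^sup>2 * kobayashi_bound a H K (sum_list hs) (sum_list ks)"
  using assms
proof (induction hs arbitrary: ks rule: rev_induct)
  case Nil
  then show ?case
    using flow_displacement_square_le[of K ks H]
    by (simp add: commute[of \<mu>] kobayashi_bound_commute[of a H])
next
  case (snoc h hs)
  note outer = snoc
  from \<open>steps_le K ks\<close> show ?case
  proof (induction ks rule: rev_induct)
    case Nil
    then show ?case using flow_displacement_square_le[OF outer(2), of K] by simp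
  next
    case (snoc k ks)
    have h: "steps_le H hs" "0 < h" "h \<le> H" "a * h \<le> 1/2" using outer(2) by simp_all
    have k: "steps_le K ks" "0 < k" "k \<le> K" "a * k \<le> 1/2" using snoc(2) by simp_all
    show ?case
    proof (rule kobayashi_bound_induct_step[OF a_nonneg h(2,4,3) _ k(2,4,3)])
      show "h \<le> sum_list (hs @ [h])" "k \<le> sum_list (ks @ [k])"
        using steps_le_sum_list_nonneg[OF h(1)] steps_le_sum_list_nonneg[OF k(1)] by simp_all
      show "(h + k - 2 * a * h * k) * (d (flow (hs @ [h])) (flow (ks @ [k])))\<^sup>2 \<le>
          k * (d (flow hs) (flow (ks @ [k])))\<^sup>2 + h * (d (flow (hs @ [h])) (flow ks))\<^sup>2"
        using prox_pair_recursion h k flow_in_D by simp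
      show "(d (flow hs) (flow (ks @ [k])))\<^sup>2 \<le>
          L\<^sup>2 * kobayashi_bound a H K (sum_list (hs @ [h]) - h) (sum_list (ks @ [k]))"
        using outer(1)[OF h(1) snoc(2)] by simp
      show "(d (flow (hs @ [h])) (flow ks))\<^sup>2 \<le>
          L\<^sup>2 * kobayashi_bound a H K (sum_list (hs @ [h])) (sum_list (ks @ [k]) - k)"
        using snoc(1)[OF k(1)] by simp
    qed simp
  qed
qed

lemma flow_dist_square_le_equal_time:
  assumes "steps_le H hs" "steps_le K ks" "sum_list hs = t" "sum_list ks = t"
  shows "(d (flow hs) (flow ks))\<^sup>2 \<le> (L * exp (4 * a * t))\<^sup>2 * t * H + (L * exp (4 * a * t))\<^sup>2 * t * K"
  using flow_dist_square_le[OF assms(1,2)]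
  by (simp add: kobayashi_bound_def assms(3,4) power_mult_distrib exp_double[symmetric] algebra_simps)

lemma uniform_steps:
  assumes "0 < t"
  obtains n\<^sub>0 where "\<And>n. n\<^sub>0 \<le> n \<Longrightarrow> steps_le (t / real n) (replicate n (t / real n)) \<and>
    sum_list (replicate n (t / real n)) = t"
proof -
  obtain m :: nat where m: "2 * a * t \<le> real m" using real_arch_simple by blast
  have "steps_le (t / real n) (replicate n (t / real n)) \<and> sum_list (replicate n (t / real n)) = t"
    if "Suc m \<le> n" for n
  proof -
    have "0 < n" "2 * a * t \<le> real n" using m that by linarith+
    then show ?thesis using assms by (auto simp: steps_le_def sum_list_replicate field_simps)
  qed
  then show ?thesis by (rule that)
qed

lemma uniform_flow_converges:
  assumes "0 < t"
  obtains S where "limitin mtopology (\<lambda>n. (J (t / real n) ^^ n) \<mu>) S sequentially"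
proof -
  obtain n\<^sub>0 where n\<^sub>0: "\<And>n. n\<^sub>0 \<le> n \<Longrightarrow> steps_le (t / real n) (replicate n (t / real n)) \<and>
      sum_list (replicate n (t / real n)) = t"
    using uniform_steps[OF assms] by blast
  define r where "r n = (L * exp (4 * a * t))\<^sup>2 * t * (t / real n)" for n
  obtain S where "limitin mtopology (\<lambda>n. flow (replicate n (t / real n))) S sequentially"
  proof (rule limitin_if_dist_square_le[OF complete])
    show "flow (replicate n (t / real n)) \<in> M" if "n\<^sub>0 \<le> n" for n
      using n\<^sub>0[OF that] flow_in_D D_imp_M by blast
    show "(d (flow (replicate m (t / real m))) (flow (replicate n (t / real n))))\<^sup>2 \<le> r m + r n"
      if "n\<^sub>0 \<le> m" "n\<^sub>0 \<le> n" for m n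
      unfolding r_def using n\<^sub>0[OF that(1)] n\<^sub>0[OF that(2)] by (intro flow_dist_square_le_equal_time) auto
    show "r \<longlonglongrightarrow> 0" unfolding r_def by (intro tendsto_mult_right_zero lim_const_over_n)
  qed
  then show ?thesis using that by (simp add: flow_replicate)
qed

lemma uniform_flow_limit_dist_le:
  assumes t: "0 < t" and lim: "limitin mtopology (\<lambda>n. (J (t / real n) ^^ n) \<mu>) S sequentially"
    and hs: "steps_le H hs" "sum_list hs = t"
  shows "d S (flow hs) \<le> L * sqrt (H * t) * exp (4 * a * t)"
proof -
  obtain n\<^sub>0 where n\<^sub>0: "\<And>n. n\<^sub>0 \<le> n \<Longrightarrow> steps_le (t / real n) (replicate n (t / real n)) \<and>
      sum_list (replicate n (t / real n)) = t"
    using uniform_steps[OF t] by blast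
  define C where "C = L * exp (4 * a * t)"
  have "(\<lambda>n. (d (flow hs) (flow (replicate n (t / real n))))\<^sup>2) \<longlonglongrightarrow> (d (flow hs) S)\<^sup>2"
    unfolding flow_replicate using flow_in_D[OF hs(1)]
    by (intro tendsto_power tendsto_dist_if_limitin[OF lim] D_imp_M)
  moreover have "(\<lambda>n. C\<^sup>2 * t * H + C\<^sup>2 * t * (t / real n)) \<longlonglongrightarrow> C\<^sup>2 * t * H + 0"
    by (intro tendsto_add tendsto_const tendsto_mult_right_zero lim_const_over_n)
  moreover have "(d (flow hs) (flow (replicate n (t / real n))))\<^sup>2 \<le>
      C\<^sup>2 * t * H + C\<^sup>2 * t * (t / real n)" if "n\<^sub>0 \<le> n" for n
    unfolding C_def using n\<^sub>0[OF that] hs by (intro flow_dist_square_le_equal_time) auto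
  ultimately have "(d (flow hs) S)\<^sup>2 \<le> C\<^sup>2 * t * H + 0" by (intro LIMSEQ_le) auto
  also have "\<dots> = (C * sqrt (H * t))\<^sup>2" using t hs(1) by (simp add: power_mult_distrib steps_le_def)
  finally have "d (flow hs) S \<le> C * sqrt (H * t)"
    by (rule power2_le_imp_le) (use t hs(1) \<mu>(3) in \<open>simp add: C_def steps_le_def\<close>)
  then show ?thesis by (simp add: C_def commute[of S] mult_ac)
qed

end

section \<open>Wasserstein gradient flows\<close>

lemma flow_error_bound_small:
  fixes a L T \<epsilon> :: real
  assumes "0 \<le> a" "0 \<le> L" "0 < \<epsilon>"
  obtains \<delta> where "0 < \<delta>" "\<And>H t. \<lbrakk>0 < H; H < \<delta>; 0 < t; t \<le> T\<rbrakk> \<Longrightarrow>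
      a * H \<le> 1/2 \<and> L * sqrt (H * t) * exp (4 * a * t) < \<epsilon>"
proof -
  have "((\<lambda>H. L * sqrt (H * T) * exp (4 * a * T)) \<longlongrightarrow> L * sqrt (0 * T) * exp (4 * a * T)) (at_right 0)"
    by (intro tendsto_intros)
  then have "\<forall>\<^sub>F H in at_right 0. L * sqrt (H * T) * exp (4 * a * T) < \<epsilon>"
    using \<open>0 < \<epsilon>\<close> by (intro order_tendstoD(2)) auto
  moreover have "((\<lambda>H. a * H) \<longlongrightarrow> a * 0) (at_right 0)" by (intro tendsto_intros)
  then have "\<forall>\<^sub>F H in at_right 0. a * H < 1/2" by (intro order_tendstoD(2)) auto
  ultimately have "\<forall>\<^sub>F H in at_right 0. a * H < 1/2 \<and> L * sqrt (H * T) * exp (4 * a * T) < \<epsilon>"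
    by eventually_elim simp
  then obtain \<delta> where \<delta>: "0 < \<delta>" "\<And>H. 0 < H \<Longrightarrow> H < \<delta> \<Longrightarrow>
      a * H < 1/2 \<and> L * sqrt (H * T) * exp (4 * a * T) < \<epsilon>"
    by (auto simp: eventually_at_right_field)
  have "L * sqrt (H * t) * exp (4 * a * t) \<le> L * sqrt (H * T) * exp (4 * a * T)"
    if "0 < H" "0 < t" "t \<le> T" for H t
    using that assms by (intro mult_mono real_sqrt_le_mono)
      (auto intro!: mult_left_mono mult_nonneg_nonneg)
  then show ?thesis using that[OF \<delta>(1)] \<delta>(2) by (meson le_less_trans less_imp_le)
qed

lemma Max_admissible_steps_pos: "admissible_steps t hs \<Longrightarrow> 0 < Max (set hs)"
  using Max_in[of "set hs"] by (auto simp: admissible_steps_def)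

lemma slope_nonneg: "0 \<le> slope \<omega>0 E \<mu>"
  unfolding slope_def by (intro INF_greatest) simp

locale generalized_geodesically_convex =
  fixes \<omega>0 :: "'a::euclidean_space measure" and E :: "'a measure \<Rightarrow> ereal" and lam :: real
  assumes E_not_MInf: "\<And>\<nu>. \<nu> \<in> P2 \<omega>0 \<Longrightarrow> E \<nu> \<noteq> - \<infinity>"
    and E_lsc: "W2_lsc \<omega>0 E" and E_convex: "lambda_convex_gg \<omega>0 E lam"
begin

sublocale Metric_space "P2 \<omega>0" W2d
  by (rule Metric_space_P2)

definition effective_domain :: "'a measure set" where
  "effective_domain = {\<nu> \<in> P2 \<omega>0. E \<nu> < \<infinity>}"

definition energy :: "'a measure \<Rightarrow> real" where
  "energy \<nu> = real_of_ereal (E \<nu>)"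

lemma effective_domain_imp_P2: "\<nu> \<in> effective_domain \<Longrightarrow> \<nu> \<in> P2 \<omega>0"
  by (simp add: effective_domain_def)

lemma E_eq_energy: "\<nu> \<in> effective_domain \<Longrightarrow> E \<nu> = ereal (energy \<nu>)"
  using E_not_MInf by (auto simp: effective_domain_def energy_def ereal_real)

lemma W2_eq: "\<mu> \<in> P2 \<omega>0 \<Longrightarrow> \<nu> \<in> P2 \<omega>0 \<Longrightarrow> W2 \<mu> \<nu> = ennreal (W2d \<mu> \<nu>)"
  by (intro W2_eq_W2d W2sq_finite)

lemma W2sq_eq: "\<mu> \<in> P2 \<omega>0 \<Longrightarrow> \<nu> \<in> P2 \<omega>0 \<Longrightarrow> W2sq \<mu> \<nu> = ennreal ((W2d \<mu> \<nu>)\<^sup>2)"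
  by (intro W2sq_eq_W2d W2sq_finite)

lemma limitin_iff_tendsto_W2:
  assumes "\<mu> \<in> P2 \<omega>0" and ev: "\<forall>\<^sub>F n in F. \<sigma> n \<in> P2 \<omega>0"
  shows "limitin mtopology \<sigma> \<mu> F \<longleftrightarrow> ((\<lambda>n. W2 (\<sigma> n) \<mu>) \<longlongrightarrow> 0) F"
proof -
  have "\<forall>\<^sub>F n in F. W2 (\<sigma> n) \<mu> = ennreal (W2d (\<sigma> n) \<mu>)"
    using ev by eventually_elim (simp add: W2_eq assms(1))
  then have "((\<lambda>n. W2 (\<sigma> n) \<mu>) \<longlongrightarrow> 0) F \<longleftrightarrow> ((\<lambda>n. ennreal (W2d (\<sigma> n) \<mu>)) \<longlongrightarrow> ennreal 0) F"
    by (simp add: tendsto_cong)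
  also have "\<dots> \<longleftrightarrow> ((\<lambda>n. W2d (\<sigma> n) \<mu>) \<longlongrightarrow> 0) F"
    by (rule tendsto_ennreal_iff) (simp_all add: W2d_nonneg)
  finally show ?thesis using assms by (simp add: limitin_metric_dist_null)
qed

lemma generalized_geodesic_gen_geod:
  assumes w: "w \<in> transport_plans x v\<^sub>0 v\<^sub>1" and P2: "x \<in> P2 \<omega>0" "v\<^sub>0 \<in> P2 \<omega>0" "v\<^sub>1 \<in> P2 \<omega>0"
  obtains q where "0 \<le> q" "W2plan_sq w = ennreal q" "generalized_geodesic x v\<^sub>0 v\<^sub>1 q (gen_geod w)"
proof -
  obtain q where q: "0 \<le> q" "W2plan_sq w = ennreal q"
    using W2plan_sq_finite[OF w W2sq_finite[OF P2(1,2)] W2sq_finite[OF P2(1,3)]]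
    by (cases "W2plan_sq w") auto
  have "(W2d x (gen_geod w \<alpha>))\<^sup>2 \<le> (1 - \<alpha>) * (W2d x v\<^sub>0)\<^sup>2 + \<alpha> * (W2d x v\<^sub>1)\<^sup>2 - \<alpha> * (1 - \<alpha>) * q"
    if \<alpha>: "0 \<le> \<alpha>" "\<alpha> \<le> 1" for \<alpha>
  proof -
    have "ennreal ((W2d x (gen_geod w \<alpha>))\<^sup>2 + \<alpha> * (1 - \<alpha>) * q) \<le>
        ennreal ((1 - \<alpha>) * (W2d x v\<^sub>0)\<^sup>2 + \<alpha> * (W2d x v\<^sub>1)\<^sup>2)"
      using W2sq_gen_geod_le[OF w \<alpha>] \<alpha> P2 gen_geod_in_P2[OF w P2 \<alpha>] q
      by (simp add: W2sq_eq ennreal_mult)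
    then show ?thesis using \<alpha> by (subst (asm) ennreal_le_iff) auto
  qed
  moreover have "(W2d v\<^sub>0 v\<^sub>1)\<^sup>2 \<le> q"
    using W2sq_le_W2plan_sq[OF w] q by (simp add: W2sq_eq P2)
  ultimately have "generalized_geodesic x v\<^sub>0 v\<^sub>1 q (gen_geod w)"
    using gen_geod_in_P2[OF w P2] by (auto simp: generalized_geodesic_def)
  then show ?thesis using q that by blast
qed

lemma energy_convex:
  assumes D: "x \<in> effective_domain" "v\<^sub>0 \<in> effective_domain" "v\<^sub>1 \<in> effective_domain"
  obtains g q where "generalized_geodesic x v\<^sub>0 v\<^sub>1 q g" "\<And>\<alpha>. \<alpha> \<in> {0..1} \<Longrightarrow> g \<alpha> \<in> effective_domain \<and>
    energy (g \<alpha>) \<le> (1 - \<alpha>) * energy v\<^sub>0 + \<alpha> * energy v\<^sub>1 + \<alpha> * (1 - \<alpha>) * (max 0 (- lam) / 2) * q"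
proof -
  note P2 = D[THEN effective_domain_imp_P2]
  obtain w where w: "w \<in> transport_plans x v\<^sub>0 v\<^sub>1" and convex: "\<And>\<alpha>. \<alpha> \<in> {0..1} \<Longrightarrow> E (gen_geod w \<alpha>) \<le>
      ereal (1 - \<alpha>) * E v\<^sub>0 + ereal \<alpha> * E v\<^sub>1 - ereal (\<alpha> * (1 - \<alpha>) * lam / 2) * enn2ereal (W2plan_sq w)"
    using E_convex P2 unfolding lambda_convex_gg_def by blast
  obtain q where q: "0 \<le> q" "W2plan_sq w = ennreal q"
    and g: "generalized_geodesic x v\<^sub>0 v\<^sub>1 q (gen_geod w)"
    using generalized_geodesic_gen_geod[OF w P2] by blast
  have "gen_geod w \<alpha> \<in> effective_domain \<and>
      energy (gen_geod w \<alpha>) \<le> (1 - \<alpha>) * energy v\<^sub>0 + \<alpha> * energy v\<^sub>1 +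
        \<alpha> * (1 - \<alpha>) * (max 0 (- lam) / 2) * q"
    if \<alpha>: "\<alpha> \<in> {0..1}" for \<alpha>
  proof -
    have E_le: "E (gen_geod w \<alpha>) \<le> ereal ((1 - \<alpha>) * energy v\<^sub>0 + \<alpha> * energy v\<^sub>1 -
        \<alpha> * (1 - \<alpha>) * lam / 2 * q)"
      using convex[OF \<alpha>] q by (simp add: E_eq_energy D)
    have dom: "gen_geod w \<alpha> \<in> effective_domain"
      using E_le gen_geod_in_P2[OF w P2] \<alpha> by (auto simp: effective_domain_def)
    then have "energy (gen_geod w \<alpha>) \<le> (1 - \<alpha>) * energy v\<^sub>0 + \<alpha> * energy v\<^sub>1 - \<alpha> * (1 - \<alpha>) * lam / 2 * q"
      using E_le by (simp add: E_eq_energy)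
    also have "\<dots> \<le> (1 - \<alpha>) * energy v\<^sub>0 + \<alpha> * energy v\<^sub>1 + \<alpha> * (1 - \<alpha>) * (max 0 (- lam) / 2) * q"
      using mult_left_mono[of "- lam" "max 0 (- lam)" "\<alpha> * (1 - \<alpha>) / 2 * q"] \<alpha> q(1)
      by (simp add: mult_ac)
    finally show ?thesis using dom by blast
  qed
  then show ?thesis by (rule that[OF g])
qed

sublocale convex_energy "P2 \<omega>0" W2d effective_domain energy "max 0 (- lam)"
proof
  show "effective_domain \<subseteq> P2 \<omega>0" by (auto simp: effective_domain_def)
  show mcomplete by (rule mcomplete_P2)
  show "\<nu> \<in> effective_domain \<and> energy \<nu> \<le> l"
    if \<sigma>: "\<And>n. \<sigma> n \<in> effective_domain" and lim: "limitin mtopology \<sigma> \<nu> sequentially"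
      and le: "\<And>n. energy (\<sigma> n) \<le> c n" and c: "c \<longlonglongrightarrow> l" for \<sigma> \<nu> c l
  proof -
    have P2: "\<nu> \<in> P2 \<omega>0" "\<And>n. \<sigma> n \<in> P2 \<omega>0" using lim \<sigma> effective_domain_imp_P2
      by (auto simp: limitin_metric_dist_null)
    have "(\<lambda>n. W2 (\<sigma> n) \<nu>) \<longlonglongrightarrow> 0"
      using lim limitin_iff_tendsto_W2[OF P2(1), of \<sigma> sequentially] P2(2) by simp
    then have "E \<nu> \<le> liminf (\<lambda>n. E (\<sigma> n))"
      using E_lsc P2 unfolding W2_lsc_def by blast
    also have "\<dots> \<le> liminf (\<lambda>n. ereal (c n))"
      using le by (intro Liminf_mono) (simp add: E_eq_energy[OF \<sigma>])
    also have "\<dots> = ereal l" using c by (intro lim_imp_Liminf) auto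
    finally have E_le: "E \<nu> \<le> ereal l" .
    then have "\<nu> \<in> effective_domain" using P2(1) by (auto simp: effective_domain_def)
    then show ?thesis using E_le by (simp add: E_eq_energy)
  qed
  show "\<exists>g q. generalized_geodesic x v\<^sub>0 v\<^sub>1 q g \<and> (\<forall>\<alpha>\<in>{0..1}. g \<alpha> \<in> effective_domain \<and>
      energy (g \<alpha>) \<le> (1 - \<alpha>) * energy v\<^sub>0 + \<alpha> * energy v\<^sub>1 + \<alpha> * (1 - \<alpha>) * (max 0 (- lam) / 2) * q)"
    if "x \<in> effective_domain" "v\<^sub>0 \<in> effective_domain" "v\<^sub>1 \<in> effective_domain" for x v\<^sub>0 v\<^sub>1
    using energy_convex[OF that] by metis
qed simp

lemma slope_le_if_slope_eq:
  assumes \<mu>: "\<mu> \<in> effective_domain" and L: "slope \<omega>0 E \<mu> = ereal L"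
  shows "slope_le \<mu> L"
  unfolding slope_le_def
proof (intro allI impI)
  fix L' assume "L' > L"
  then have "slope \<omega>0 E \<mu> < ereal L'" by (simp add: L)
  then obtain \<delta> :: real where \<delta>: "\<delta> > 0"
    and sup_less: "sup 0 (SUP \<nu>\<in>{\<nu>\<in>P2 \<omega>0. 0 < W2 \<mu> \<nu> \<and> W2 \<mu> \<nu> < ennreal \<delta>}.
      max 0 (E \<mu> - E \<nu>) / enn2ereal (W2 \<mu> \<nu>)) < ereal L'"
    unfolding slope_def INF_less_iff by auto
  have "energy \<mu> - energy \<nu> \<le> L' * W2d \<mu> \<nu>"
    if \<nu>: "\<nu> \<in> effective_domain" "0 < W2d \<mu> \<nu>" "W2d \<mu> \<nu> < \<delta>" for \<nu>
  proof -
    have W2: "W2 \<mu> \<nu> = ennreal (W2d \<mu> \<nu>)" using \<mu> \<nu>(1) by (intro W2_eq effective_domain_imp_P2)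
    have "\<nu> \<in> {\<nu>\<in>P2 \<omega>0. 0 < W2 \<mu> \<nu> \<and> W2 \<mu> \<nu> < ennreal \<delta>}"
      using \<nu> \<delta> by (simp add: W2 effective_domain_imp_P2 ennreal_lessI del: zero)
    then have "max 0 (E \<mu> - E \<nu>) / enn2ereal (W2 \<mu> \<nu>) \<le>
        (SUP \<nu>\<in>{\<nu>\<in>P2 \<omega>0. 0 < W2 \<mu> \<nu> \<and> W2 \<mu> \<nu> < ennreal \<delta>}.
        max 0 (E \<mu> - E \<nu>) / enn2ereal (W2 \<mu> \<nu>))" by (rule SUP_upper)
    also have "\<dots> \<le> ereal L'" using sup_less by (meson le_sup_iff less_imp_le)
    also have "max 0 (E \<mu> - E \<nu>) / enn2ereal (W2 \<mu> \<nu>) = ereal (max 0 (energy \<mu> - energy \<nu>) / W2d \<mu> \<nu>)"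
      using \<nu>(2) by (simp add: W2 E_eq_energy \<mu> \<nu>(1) max_def zero_ereal_def)
    finally have "max 0 (energy \<mu> - energy \<nu>) \<le> L' * W2d \<mu> \<nu>" using \<nu>(2) by (simp add: pos_divide_le_eq)
    then show ?thesis by simp
  qed
  then show "\<exists>\<delta>>0. \<forall>\<nu>\<in>effective_domain. 0 < W2d \<mu> \<nu> \<and> W2d \<mu> \<nu> < \<delta> \<longrightarrow> energy \<mu> - energy \<nu> \<le> L' * W2d \<mu> \<nu>"
    using \<delta> by blast
qed

lemma is_prox_Jstep:
  assumes h: "0 < h" "max 0 (- lam) * h \<le> 1/2" and x: "x \<in> effective_domain"
    and \<mu>: "\<mu> \<in> effective_domain" "slope_le \<mu> L" "0 \<le> L"
  shows "is_prox h x (Jstep \<omega>0 E h x)"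
proof -
  define \<Phi> where "\<Phi> \<nu> = ereal (1 / (2 * h)) * enn2ereal (W2sq x \<nu>) + E \<nu>" for \<nu>
  have \<Phi>: "\<Phi> \<nu> = ereal (proximal_energy h x \<nu>)" if "\<nu> \<in> effective_domain" for \<nu>
    using that x by (simp add: \<Phi>_def proximal_energy_def E_eq_energy W2sq_eq effective_domain_imp_P2)
  have \<Phi>_infty: "\<Phi> \<nu> = \<infinity>" if "\<nu> \<in> P2 \<omega>0" "\<nu> \<notin> effective_domain" for \<nu>
    using that x by (auto simp: \<Phi>_def effective_domain_def W2sq_eq)
  obtain y where y: "is_prox h x y"
    using is_prox_exists[OF x h(1) _ proximal_energy_bdd_below[OF \<mu> x h]] h(2) by auto
  have "\<Phi> y \<le> \<Phi> \<nu>" if "\<nu> \<in> P2 \<omega>0" for \<nu>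
    using y that by (cases "\<nu> \<in> effective_domain") (auto simp: is_prox_def \<Phi> \<Phi>_infty)
  then have "y \<in> P2 \<omega>0 \<and> (\<forall>\<nu>\<in>P2 \<omega>0. \<Phi> y \<le> \<Phi> \<nu>)" using y
    by (simp add: is_prox_def effective_domain_imp_P2)
  then have J: "Jstep \<omega>0 E h x \<in> P2 \<omega>0 \<and> (\<forall>\<nu>\<in>P2 \<omega>0. \<Phi> (Jstep \<omega>0 E h x) \<le> \<Phi> \<nu>)"
    unfolding Jstep_def \<Phi>_def by (rule someI)
  have "\<Phi> (Jstep \<omega>0 E h x) \<le> \<Phi> x" using J x effective_domain_imp_P2 by blast
  then have dom: "Jstep \<omega>0 E h x \<in> effective_domain" using J \<Phi>_infty \<Phi>[OF x] by fastforce
  have "proximal_energy h x (Jstep \<omega>0 E h x) \<le> proximal_energy h x \<nu>" if "\<nu> \<in> effective_domain" for \<nu>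
    using J effective_domain_imp_P2[OF that] \<Phi>[OF dom] \<Phi>[OF that] by force
  then show ?thesis using dom by (simp add: is_prox_def)
qed

lemma Sflow_eqI:
  assumes lim: "limitin mtopology (\<lambda>n. (Jstep \<omega>0 E (t / real n) ^^ n) \<mu>) S sequentially"
  shows "Sflow \<omega>0 E t \<mu> = S"
  unfolding Sflow_def
proof (rule the_equality)
  have S: "S \<in> P2 \<omega>0" and ev: "\<forall>\<^sub>F n in sequentially. (Jstep \<omega>0 E (t / real n) ^^ n) \<mu> \<in> P2 \<omega>0"
    using lim by (auto simp: limitin_metric_dist_null)
  show "S \<in> P2 \<omega>0 \<and> (\<lambda>n. W2 ((Jstep \<omega>0 E (t / real n) ^^ n) \<mu>) S) \<longlonglongrightarrow> 0"
    using S lim limitin_iff_tendsto_W2[OF S ev] by simp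
  show "\<nu> = S" if "\<nu> \<in> P2 \<omega>0 \<and> (\<lambda>n. W2 ((Jstep \<omega>0 E (t / real n) ^^ n) \<mu>) \<nu>) \<longlonglongrightarrow> 0" for \<nu>
    using that limitin_iff_tendsto_W2[OF _ ev] limitin_metric_unique[OF _ lim] by simp
qed

lemma W2_Sflow_disc_flow_le:
  assumes \<mu>: "\<mu> \<in> effective_domain" and L: "slope \<omega>0 E \<mu> = ereal L" "0 \<le> L"
    and t: "0 < t" and hs: "admissible_steps t hs" and small: "max 0 (- lam) * Max (set hs) \<le> 1/2"
  shows "W2 (Sflow \<omega>0 E t \<mu>) (disc_flow \<omega>0 E hs \<mu>) \<le>
      ennreal (L * sqrt (Max (set hs) * t) * exp (4 * max 0 (- lam) * t))"
proof -
  have slope: "slope_le \<mu> L" by (rule slope_le_if_slope_eq[OF \<mu> L(1)])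
  interpret proximal_flow "P2 \<omega>0" W2d effective_domain energy "max 0 (- lam)" "Jstep \<omega>0 E" \<mu> L
    by unfold_locales (use is_prox_Jstep[OF _ _ _ \<mu> slope L(2)] \<mu> slope L(2) in auto)
  have steps: "steps_le (Max (set hs)) hs"
    unfolding steps_le_def
  proof (intro conjI ballI)
    have pos: "hs \<noteq> []" "\<And>h. h \<in> set hs \<Longrightarrow> 0 < h" using hs by (auto simp: admissible_steps_def)
    then show "0 \<le> Max (set hs)" using Max_in[of "set hs"] by (auto intro: less_imp_le)
    fix h assume h: "h \<in> set hs"
    then show "0 < h" "h \<le> Max (set hs)" using pos by auto
    then show "max 0 (- lam) * h \<le> 1/2"
      using small mult_left_mono[of h "Max (set hs)" "max 0 (- lam)"] by simp
  qed
  obtain S where S: "limitin mtopology (\<lambda>n. (Jstep \<omega>0 E (t / real n) ^^ n) \<mu>) S sequentially"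
    using uniform_flow_converges[OF t] by blast
  have "W2d S (flow hs) \<le> L * sqrt (Max (set hs) * t) * exp (4 * max 0 (- lam) * t)"
    using hs by (intro uniform_flow_limit_dist_le[OF t S steps]) (simp add: admissible_steps_def)
  moreover have "disc_flow \<omega>0 E hs \<mu> = flow hs" by (simp add: disc_flow_def flow_def)
  moreover have "W2 S (flow hs) = ennreal (W2d S (flow hs))"
    using S by (intro W2_eq[OF _ effective_domain_imp_P2[OF flow_in_D[OF steps]]])
      (simp add: limitin_metric_dist_null)
  ultimately show ?thesis by (simp add: Sflow_eqI[OF S] ennreal_leI)
qed

lemma disc_flow_converges_uniformly:
  assumes \<mu>: "\<mu> \<in> effective_domain" and L: "slope \<omega>0 E \<mu> = ereal L" "0 \<le> L" and "0 < \<epsilon>"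
  shows "\<exists>\<delta>>0. \<forall>t hs. 0 < t \<and> t \<le> T \<and> admissible_steps t hs \<and> Max (set hs) < \<delta>
    \<longrightarrow> W2 (Sflow \<omega>0 E t \<mu>) (disc_flow \<omega>0 E hs \<mu>) < ennreal \<epsilon>"
proof -
  obtain \<delta> where "0 < \<delta>" and \<delta>: "\<And>H t. \<lbrakk>0 < H; H < \<delta>; 0 < t; t \<le> T\<rbrakk> \<Longrightarrow>
      max 0 (- lam) * H \<le> 1/2 \<and> L * sqrt (H * t) * exp (4 * max 0 (- lam) * t) < \<epsilon>"
    using flow_error_bound_small[of "max 0 (- lam)" L \<epsilon> T] L(2) \<open>0 < \<epsilon>\<close> by auto
  have "W2 (Sflow \<omega>0 E t \<mu>) (disc_flow \<omega>0 E hs \<mu>) < ennreal \<epsilon>"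
    if t: "0 < t" "t \<le> T" and hs: "admissible_steps t hs" "Max (set hs) < \<delta>" for t hs
  proof (rule le_less_trans)
    note small = \<delta>[OF Max_admissible_steps_pos[OF hs(1)] hs(2) t]
    then show "W2 (Sflow \<omega>0 E t \<mu>) (disc_flow \<omega>0 E hs \<mu>) \<le>
        ennreal (L * sqrt (Max (set hs) * t) * exp (4 * max 0 (- lam) * t))"
      by (intro W2_Sflow_disc_flow_le[OF \<mu> L t(1) hs(1)]) simp
    show "ennreal (L * sqrt (Max (set hs) * t) * exp (4 * max 0 (- lam) * t)) < ennreal \<epsilon>"
      using small \<open>0 < \<epsilon>\<close> by (intro ennreal_lessI) auto
  qed
  then show ?thesis using \<open>0 < \<delta>\<close> by blast
qed

lemma disc_flow_error_estimate:
  assumes \<mu>: "\<mu> \<in> effective_domain" and L: "slope \<omega>0 E \<mu> = ereal L" "0 \<le> L"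
    and t: "0 < t" and hs: "admissible_steps t hs"
    and small: "max 0 (- lam) = 0 \<or> Max (set hs) \<le> 1 / (2 * max 0 (- lam))"
  shows "enn2ereal (W2 (Sflow \<omega>0 E t \<mu>) (disc_flow \<omega>0 E hs \<mu>)) \<le>
    ereal (2 * sqrt ((Max (set hs))\<^sup>2 + 3 * Max (set hs) * t) * exp (4 * max 0 (- lam) * t)) *
      slope \<omega>0 E \<mu>"
proof -
  define H a where "H = Max (set hs)" and "a = max 0 (- lam)"
  have H: "0 < H" using Max_admissible_steps_pos[OF hs] by (simp add: H_def)
  have "a * H \<le> 1/2"
  proof (cases "a = 0")
    case False
    then have "0 < a" "H \<le> 1 / (2 * a)" using small by (auto simp: a_def H_def)
    then show ?thesis by (simp add: field_simps)
  qed simp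
  then have "W2 (Sflow \<omega>0 E t \<mu>) (disc_flow \<omega>0 E hs \<mu>) \<le> ennreal (L * sqrt (H * t) * exp (4 * a * t))"
    unfolding a_def H_def by (rule W2_Sflow_disc_flow_le[OF \<mu> L t hs])
  then have "enn2ereal (W2 (Sflow \<omega>0 E t \<mu>) (disc_flow \<omega>0 E hs \<mu>)) \<le>
      ereal (L * sqrt (H * t) * exp (4 * a * t))"
    using L(2) H t by (simp add: less_eq_ennreal.rep_eq)
  also have "\<dots> \<le> ereal (L * (2 * sqrt (H\<^sup>2 + 3 * H * t)) * exp (4 * a * t))"
  proof -
    have "sqrt (H * t) \<le> sqrt (4 * (H\<^sup>2 + 3 * H * t))" using H t by (intro real_sqrt_le_mono) simp
    also have "\<dots> = 2 * sqrt (H\<^sup>2 + 3 * H * t)" by (simp only: real_sqrt_mult real_sqrt_four)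
    finally show ?thesis using L(2) by (auto intro!: mult_right_mono mult_left_mono)
  qed
  finally show ?thesis by (simp add: L(1) H_def a_def mult_ac)
qed

end

theorem theoremA4:
  fixes \<omega>0 :: "'a::euclidean_space measure"
    and E :: "'a measure \<Rightarrow> ereal"
    and lam :: real
    and \<mu> :: "'a measure"
  assumes "\<omega>0 \<in> Pm"
    and "\<forall>\<nu>\<in>P2 \<omega>0. E \<nu> \<noteq> - \<infinity>"
    and "proper_fun \<omega>0 E"
    and "coercive \<omega>0 E"
    and "W2_lsc \<omega>0 E"
    and "lambda_convex_gg \<omega>0 E lam"
    and "\<mu> \<in> P2 \<omega>0" and "E \<mu> < \<infinity>" and "slope \<omega>0 E \<mu> < \<infinity>"
  shows "(\<forall>T>0. \<forall>\<epsilon>>0. \<exists>\<delta>>0. \<forall>t hs. 0 < t \<and> t \<le> T \<and> admissible_steps t hs \<and> Max (set hs) < \<delta>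
            \<longrightarrow> W2 (Sflow \<omega>0 E t \<mu>) (disc_flow \<omega>0 E hs \<mu>) < ennreal \<epsilon>)
       \<and> (\<forall>t hs. 0 < t \<and> admissible_steps t hs \<and>
            (max 0 (- lam) = 0 \<or> Max (set hs) \<le> 1 / (2 * max 0 (- lam)))
            \<longrightarrow> enn2ereal (W2 (Sflow \<omega>0 E t \<mu>) (disc_flow \<omega>0 E hs \<mu>))
                \<le> ereal (2 * sqrt ((Max (set hs))\<^sup>2 + 3 * Max (set hs) * t) * exp (4 * max 0 (- lam) * t))
                   * slope \<omega>0 E \<mu>)"
proof -
  interpret generalized_geodesically_convex \<omega>0 E lam
    using assms by unfold_locales auto
  have \<mu>: "\<mu> \<in> effective_domain" using assms by (simp add: effective_domain_def)
  obtain L where L: "slope \<omega>0 E \<mu> = ereal L" "0 \<le> L"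
    using slope_nonneg[of \<omega>0 E \<mu>] assms(9) by (cases "slope \<omega>0 E \<mu>") auto
  show ?thesis
    using disc_flow_converges_uniformly[OF \<mu> L] disc_flow_error_estimate[OF \<mu> L] by blast
qed

end
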